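(* Let $n\ge 2$ be an integer, let $\mathcal X_n=(a=x_0<x_1<\dots<x_n=b)$ be a symmetrically stretched knot sequence, and consider the Gaussian quadrature rule $\int_a^b f(t)\,dt\simeq\sum_{i=1}^{n+1}\omega_i f(\tau_i)$, with $n+1$ nodes $\tau_1<\dots<\tau_{n+1}$ in $[a,b]$ and weights $\omega_i$, that is exact for every $f$ in the space $S^n_{3,1}$ of $C^1$ cubic splines over $\mathcal X_n$. With the notation $h_k,a_k,b_k,c_k,\alpha_k,\beta_k,\gamma_k,\eta_k,\theta_k,\rho_k,A_k,B_k$ of the context, the nodes (through $\theta_k=x_k-\tau_k$) and weights of this rule are given explicitly as follows. $$\theta_1=\tfrac34 h_1,\qquad \omega_1=\tfrac{16}{27}h_1,$$ and, for $i=1,2,\dots,[n/2]-1$, by the recurrence relations $$\theta_{i+1}=\frac{A_i\,\beta_{i+1}}{a_{i+1}B_i-\alpha_{i+1}A_i},\qquad \omega_{i+1}=\frac{A_i}{a_{i+1}\theta_{i+1}^3}.$$ If $n=2m$ is even, then $\tau_{m+1}=x_m=(a+b)/2$ and $$\omega_{m+1}=\frac{A_m+B_m-\frac14}{a_{m+1}\theta_{m+1}^3}.$$ If $n=2m-1$ is odd, then $\theta_m$ is the greater root in $(0,x_m-x_{m-1})$ of the cubic equation (in the unknown $\theta_m$, with $\rho_m=\theta_m+x_{m+1}-x_m$) $$\begin{aligned}&\bigl(A_{m-1}(\alpha_m+b_{m+1})-B_{m-1}(a_m+\gamma_{m+1})\bigr)\theta_m^3+\bigl(A_{m-1}(\beta_m+c_{m+1})-B_{m-1}\eta_{m+1}\bigr)\theta_m^2\\&\quad+(A_{m-1}a_{m+1}-B_{m-1}\alpha_{m+1})\rho_m^3-B_{m-1}\beta_{m+1}\rho_m^2=0,\end{aligned}$$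 and $$\omega_m=\frac{A_{m-1}}{(\gamma_{m+1}+a_m)\theta_m^3+\eta_{m+1}\theta_m^2+\alpha_{m+1}\rho_m^3+\beta_{m+1}\rho_m^2}.$$
   Context: Throughout, $[a,b]$ is a non-trivial compact real interval and $[\cdot]$ applied to a number is the integer part. A finite sequence $\mathcal X_n=(a=x_0<x_1<\dots<x_{n-1}<x_n=b)$ is a symmetrically stretched knot sequence if it is symmetric with respect to the midpoint of $[a,b]$ (i.e. $x_k+x_{n-k}=a+b$ for all $k$) and $x_k-2x_{k+1}+x_{k+2}\ge 0$ for $k=0,\dots,[n/2]-1$. $S^n_{3,1}=\{f\in C^1[a,b]: f|_{(x_k,x_{k+1})}\text{ is a polynomial of degree at most }3,\ k=0,\dots,n-1\}$; its dimension is $2n+2$. Gaussian quadrature rule: a rule $\sum_{i=1}^{n+1}\omega_i f(\tau_i)$ with $n+1$ nodes $\tau_1<\dots<\tau_{n+1}$ in $[a,b]$ and real weights $\omega_i$ that equals $\int_a^b f(t)\,dt$ for every $f\in S^n_{3,1}$. The existence of such a rule is known (Micchelli, Pinkus). Extend the knots by $x_{-1}=2x_0-x_1$ and $x_{n+1}=2x_n-x_{n-1}$, and set $h_k=x_k-x_{k-1}$ for $k=0,1,\dots,n+1$. For $k=1,\dots,n+1$ put $$a_k=\frac{1}{h_k^2(h_k+h_{k-1})^2},\quad b_k=\frac{2h_k-h_{k-1}}{h_{k-1}^3h_k^2},\quad c_k=\frac{-3}{h_{k-1}^2h_k},$$ $$\alpha_k=\frac{-3h_k-2h_{k-1}}{(h_k+h_{k-1})^2h_k^3},\quad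 \beta_k=\frac{3}{(h_k+h_{k-1})h_k^2},\quad \gamma_k=\frac{2h_{k-1}-h_k}{h_{k-1}^2h_k^3},\quad \eta_k=\frac{3}{h_{k-1}h_k^2}.$$ For $k=1,2,\dots,[n/2]+1$ set $\theta_k=x_k-\tau_k$ and $\rho_k=x_{k+1}-\tau_k$, and (for those indices $k$ for which they are used) $$A_k=\tfrac14-\omega_k\left(a_{k+1}\rho_k^3+b_{k+1}\theta_k^3+c_{k+1}\theta_k^2\right),$$ $$B_k=\tfrac14-\omega_k\left(\alpha_{k+1}\rho_k^3+\beta_{k+1}\rho_k^2+\gamma_{k+1}\theta_k^3+\eta_{k+1}\theta_k^2\right).$$ *)

theory Defs
  imports "HOL-Analysis.Analysis" "HOL-Computational_Algebra.Polynomial"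
begin

definition symmetrically_stretched_knots :: "real \<Rightarrow> real \<Rightarrow> nat \<Rightarrow> (nat \<Rightarrow> real) \<Rightarrow> bool" where
  "symmetrically_stretched_knots a b n x \<longleftrightarrow>
     x 0 = a \<and> x n = b \<and> (\<forall>k<n. x k < x (k + 1)) \<and>
     (\<forall>k\<le>n. x k + x (n - k) = a + b) \<and>
     (\<forall>k<n div 2. x k - 2 * x (k + 1) + x (k + 2) \<ge> 0)"

text \<open>The derivative is taken within the interval, so it is one-sided at the end points.\<close>

definition C1_on_interval :: "real \<Rightarrow> real \<Rightarrow> (real \<Rightarrow> real) \<Rightarrow> bool" where
  "C1_on_interval a b f \<longleftrightarrow>
     (\<exists>f'. (\<forall>t\<in>{a..b}. (f has_real_derivative f' t) (at t within {a..b})) \<and>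
           continuous_on {a..b} f')"

text \<open>Functions on the interval are represented by total functions whose values outside
  the interval are irrelevant.\<close>

definition cubic_splines_C1 :: "nat \<Rightarrow> (nat \<Rightarrow> real) \<Rightarrow> (real \<Rightarrow> real) set" where
  "cubic_splines_C1 n x =
     {f. C1_on_interval (x 0) (x n) f \<and>
         (\<forall>k<n. \<exists>p :: real poly. degree p \<le> 3 \<and> (\<forall>t\<in>{x k<..<x (k + 1)}. f t = poly p t))}"

text \<open>Only \<open>\<tau> i\<close> and \<open>\<omega> i\<close> with \<open>1 \<le> i \<le> n + 1\<close> matter.\<close>

definition gaussian_rule :: "nat \<Rightarrow> (nat \<Rightarrow> real) \<Rightarrow> (nat \<Rightarrow> real) \<Rightarrow> (nat \<Rightarrow> real) \<Rightarrow> bool" where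
  "gaussian_rule n x \<tau> \<omega> \<longleftrightarrow>
     (\<forall>i\<in>{1..n + 1}. \<tau> i \<in> {x 0..x n}) \<and>
     (\<forall>i\<in>{1..n}. \<tau> i < \<tau> (i + 1)) \<and>
     (\<forall>f\<in>cubic_splines_C1 n x. (\<Sum>i = 1..n + 1. \<omega> i * f (\<tau> i)) = integral {x 0..x n} f)"

text \<open>The knots extended to the indices \<open>-1\<close> and \<open>n + 1\<close>.\<close>

definition knot :: "nat \<Rightarrow> (nat \<Rightarrow> real) \<Rightarrow> int \<Rightarrow> real" where
  "knot n x k =
     (if k = -1 then 2 * x 0 - x 1
      else if k = int n + 1 then 2 * x n - x (n - 1)
      else x (nat k))"

definition step :: "nat \<Rightarrow> (nat \<Rightarrow> real) \<Rightarrow> nat \<Rightarrow> real" where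
  "step n x k = knot n x (int k) - knot n x (int k - 1)"

text \<open>The coefficients are meant for indices \<open>1 \<le> k \<le> n + 1\<close>.\<close>

definition coef_a :: "nat \<Rightarrow> (nat \<Rightarrow> real) \<Rightarrow> nat \<Rightarrow> real" where
  "coef_a n x k = (let h = step n x in 1 / (h k ^ 2 * (h k + h (k - 1)) ^ 2))"

definition coef_b :: "nat \<Rightarrow> (nat \<Rightarrow> real) \<Rightarrow> nat \<Rightarrow> real" where
  "coef_b n x k = (let h = step n x in (2 * h k - h (k - 1)) / (h (k - 1) ^ 3 * h k ^ 2))"

definition coef_c :: "nat \<Rightarrow> (nat \<Rightarrow> real) \<Rightarrow> nat \<Rightarrow> real" where
  "coef_c n x k = (let h = step n x in - 3 / (h (k - 1) ^ 2 * h k))"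

definition coef_alpha :: "nat \<Rightarrow> (nat \<Rightarrow> real) \<Rightarrow> nat \<Rightarrow> real" where
  "coef_alpha n x k =
     (let h = step n x in (- 3 * h k - 2 * h (k - 1)) / ((h k + h (k - 1)) ^ 2 * h k ^ 3))"

definition coef_beta :: "nat \<Rightarrow> (nat \<Rightarrow> real) \<Rightarrow> nat \<Rightarrow> real" where
  "coef_beta n x k = (let h = step n x in 3 / ((h k + h (k - 1)) * h k ^ 2))"

definition coef_gamma :: "nat \<Rightarrow> (nat \<Rightarrow> real) \<Rightarrow> nat \<Rightarrow> real" where
  "coef_gamma n x k = (let h = step n x in (2 * h (k - 1) - h k) / (h (k - 1) ^ 2 * h k ^ 3))"

definition coef_eta :: "nat \<Rightarrow> (nat \<Rightarrow> real) \<Rightarrow> nat \<Rightarrow> real" where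
  "coef_eta n x k = (let h = step n x in 3 / (h (k - 1) * h k ^ 2))"

definition node_theta :: "nat \<Rightarrow> (nat \<Rightarrow> real) \<Rightarrow> (nat \<Rightarrow> real) \<Rightarrow> nat \<Rightarrow> real" where
  "node_theta n x \<tau> k = knot n x (int k) - \<tau> k"

definition node_rho :: "nat \<Rightarrow> (nat \<Rightarrow> real) \<Rightarrow> (nat \<Rightarrow> real) \<Rightarrow> nat \<Rightarrow> real" where
  "node_rho n x \<tau> k = knot n x (int k + 1) - \<tau> k"

definition coef_A ::
  "nat \<Rightarrow> (nat \<Rightarrow> real) \<Rightarrow> (nat \<Rightarrow> real) \<Rightarrow> (nat \<Rightarrow> real) \<Rightarrow> nat \<Rightarrow> real" where
  "coef_A n x \<tau> \<omega> k =
     (let \<theta> = node_theta n x \<tau> k; \<rho> = node_rho n x \<tau> k in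
      1 / 4 - \<omega> k * (coef_a n x (k + 1) * \<rho> ^ 3 + coef_b n x (k + 1) * \<theta> ^ 3
                      + coef_c n x (k + 1) * \<theta> ^ 2))"

definition coef_B ::
  "nat \<Rightarrow> (nat \<Rightarrow> real) \<Rightarrow> (nat \<Rightarrow> real) \<Rightarrow> (nat \<Rightarrow> real) \<Rightarrow> nat \<Rightarrow> real" where
  "coef_B n x \<tau> \<omega> k =
     (let \<theta> = node_theta n x \<tau> k; \<rho> = node_rho n x \<tau> k in
      1 / 4 - \<omega> k * (coef_alpha n x (k + 1) * \<rho> ^ 3 + coef_beta n x (k + 1) * \<rho> ^ 2
                      + coef_gamma n x (k + 1) * \<theta> ^ 3 + coef_eta n x (k + 1) * \<theta> ^ 2))"

text \<open>Left-hand side, at the point \<open>t\<close>, of the cubic equation for the last unknown node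
  of the first half when \<open>n = 2 * m - 1\<close>.  The unknown also enters through
  \<open>\<rho> = t + x (m + 1) - x m\<close>, whereas \<open>A\<close> and \<open>B\<close> at \<open>m - 1\<close> are independent of it.\<close>

definition middle_cubic ::
  "nat \<Rightarrow> (nat \<Rightarrow> real) \<Rightarrow> (nat \<Rightarrow> real) \<Rightarrow> (nat \<Rightarrow> real) \<Rightarrow> nat \<Rightarrow> real \<Rightarrow> real" where
  "middle_cubic n x \<tau> \<omega> m t =
     (let A = coef_A n x \<tau> \<omega> (m - 1); B = coef_B n x \<tau> \<omega> (m - 1);
          \<rho> = t + x (m + 1) - x m in
      (A * (coef_alpha n x m + coef_b n x (m + 1)) - B * (coef_a n x m + coef_gamma n x (m + 1))) * t ^ 3
      + (A * (coef_beta n x m + coef_c n x (m + 1)) - B * coef_eta n x (m + 1)) * t ^ 2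
      + (A * coef_a n x (m + 1) - B * coef_alpha n x (m + 1)) * \<rho> ^ 3
      - B * coef_beta n x (m + 1) * \<rho> ^ 2)"

end

theory Submission
  imports Defs
begin

text \<open>
  Exactness for the truncated powers \<open>(x j - t)\<^sub>+\<close> to the exponents 2 and 3 says that the error of
  the rule on \<open>{x 0..x j}\<close> has the form \<open>P * f (x j) - V * f' (x j)\<close>. So a cell with a single
  node determines the node, its weight and the next state \<open>(P, V)\<close>, and this recursion is the
  formula of the theorem. The work is to show that the cells of the left half do contain one node
  each. While they do, the state stays in the region \<open>0 \<le> P\<close>, \<open>0 \<le> V \<le> h\<^sup>2 / 12\<close>; increasing cell
  lengths preserve this region, and an empty cell would need \<open>P = - h / 2\<close>. A cell with two nodes
  pushes \<open>V\<close> strictly below its value for the one-node rule, as long as \<open>P \<le> 0 \<le> V\<close> later on.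
  The reflected rule satisfies the same equations; both halves must fit together at the middle,
  where \<open>V\<close> agrees and the two values of \<open>P\<close> add up to the weight of a node at that knot. Counting
  the \<open>n + 1\<close> nodes then leaves only the configuration claimed. For odd \<open>n\<close> one uses in addition
  that \<open>V\<close> strictly increases along the one-node recursion.
\<close>

section \<open>Truncated powers\<close>

text \<open>Only \<open>0\<close> is delicate: there the difference quotient is
  \<open>max 0 h ^ k\<close>, which tends to \<open>0\<close> because \<open>k > 0\<close>.\<close>

lemma has_real_derivative_max_power:
  fixes s :: real
  assumes "k > 0"
  shows "((\<lambda>s. max 0 s ^ Suc k) has_real_derivative real (Suc k) * max 0 s ^ k) (at s)"
proof -
  consider "s > 0" | "s < 0" | "s = 0" by linarith
  thus ?thesis
  proof cases
    case 1
    have "((\<lambda>s. s ^ Suc k) has_real_derivative real (Suc k) * max 0 s ^ k) (at s)"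
      using 1 DERIV_pow[of "Suc k" s] by simp
    thus ?thesis
      by (rule has_field_derivative_transform_within_open[of _ _ _ "{0<..}"]) (use 1 in auto)
  next
    case 2
    have "((\<lambda>s. 0) has_real_derivative real (Suc k) * max 0 s ^ k) (at s)"
      using 2 assms by (auto intro!: derivative_eq_intros)
    thus ?thesis
      by (rule has_field_derivative_transform_within_open[of _ _ _ "{..<0}"]) (use 2 in auto)
  next
    case 3
    have "isCont (\<lambda>h::real. max 0 h ^ k) 0" by (intro continuous_intros)
    hence "(\<lambda>h::real. max 0 h ^ k) \<midarrow>0\<rightarrow> 0"
      unfolding isCont_def by (simp only: max.idem zero_power[OF assms])
    moreover have "\<forall>\<^sub>F h::real in at 0. max 0 h ^ k = max 0 h ^ Suc k / h"
      unfolding eventually_at_filter using assms by (intro always_eventually) (auto simp: max_def)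
    ultimately have "(\<lambda>h::real. max 0 h ^ Suc k / h) \<midarrow>0\<rightarrow> 0"
      by (rule Lim_transform_eventually)
    thus ?thesis using 3 assms by (simp add: has_field_derivative_iff zero_power)
  qed
qed

lemma truncated_power_derivative:
  fixes s c t :: real
  assumes "k > 0"
  shows "((\<lambda>t. max 0 (s * (t - c)) ^ Suc k) has_real_derivative
           s * (real (Suc k) * max 0 (s * (t - c)) ^ k)) (at t within A)"
proof -
  have "((\<lambda>t. s * (t - c)) has_real_derivative s) (at t)"
    by (auto intro!: derivative_eq_intros)
  from DERIV_chain2[OF has_real_derivative_max_power[OF assms] this]
  show ?thesis by (simp add: has_field_derivative_at_within mult.commute)
qed

text \<open>The factor \<open>s\<close> treats truncation on the left and on the right at once;
  \<open>sign\<close> keeps the kink out of the open cells.\<close>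

lemma truncated_power_spline:
  fixes s c :: real
  assumes k: "k > 0" "k \<le> 2"
    and sign: "\<And>j. j < n \<Longrightarrow> (\<forall>t\<in>{x j<..<x (j + 1)}. s * (t - c) \<le> 0)
                         \<or> (\<forall>t\<in>{x j<..<x (j + 1)}. s * (t - c) \<ge> 0)"
  shows "(\<lambda>t. max 0 (s * (t - c)) ^ Suc k) \<in> cubic_splines_C1 n x"
proof -
  have "\<exists>p :: real poly. degree p \<le> 3 \<and>
          (\<forall>t\<in>{x j<..<x (j + 1)}. max 0 (s * (t - c)) ^ Suc k = poly p t)" if "j < n" for j
    using sign[OF that]
  proof
    assume "\<forall>t\<in>{x j<..<x (j + 1)}. s * (t - c) \<le> 0"
    thus ?thesis by (intro exI[of _ 0]) auto
  next
    assume *: "\<forall>t\<in>{x j<..<x (j + 1)}. s * (t - c) \<ge> 0"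
    have "degree ([:- s * c, s:] ^ Suc k) \<le> Suc k" 
      using degree_power_le[of "[:- s * c, s:]" "Suc k"] by (simp split: if_splits del: power_Suc)
    moreover have "max 0 (s * (t - c)) ^ Suc k = poly ([:- s * c, s:] ^ Suc k) t"
      if "t \<in> {x j<..<x (j + 1)}" for t
    proof -
      have "max 0 (s * (t - c)) = poly [:- s * c, s:] t"
        using *[rule_format, OF that] by (simp add: algebra_simps)
      thus ?thesis by (simp only: poly_power)
    qed
    ultimately show ?thesis using k by (intro exI[of _ "[:- s * c, s:] ^ Suc k"]) auto
  qed
  moreover have "C1_on_interval (x 0) (x n) (\<lambda>t. max 0 (s * (t - c)) ^ Suc k)"
    unfolding C1_on_interval_def
    by (rule exI[of _ "\<lambda>t. s * (real (Suc k) * max 0 (s * (t - c)) ^ k)"], intro conjI ballI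
        truncated_power_derivative k continuous_intros)
  ultimately show ?thesis by (simp add: cubic_splines_C1_def)
qed

lemma truncated_power_integral:
  fixes s c a b :: real
  assumes "k > 0" "a \<le> b" "s ^ 2 = 1"
  shows "integral {a..b} (\<lambda>t. max 0 (s * (t - c)) ^ k) =
     s * (max 0 (s * (b - c)) ^ Suc k - max 0 (s * (a - c)) ^ Suc k) / real (Suc k)"
proof -
  have "((\<lambda>t. s / real (Suc k) * max 0 (s * (t - c)) ^ Suc k) has_vector_derivative
     max 0 (s * (t - c)) ^ k) (at t within {a..b})" for t
  proof -
    have "((\<lambda>t. s / real (Suc k) * max 0 (s * (t - c)) ^ Suc k) has_real_derivative
     s / real (Suc k) * (s * (real (Suc k) * max 0 (s * (t - c)) ^ k))) (at t within {a..b})"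
      by (intro DERIV_cmult truncated_power_derivative assms)
    also have "s / real (Suc k) * (s * (real (Suc k) * max 0 (s * (t - c)) ^ k)) =
        s ^ 2 * max 0 (s * (t - c)) ^ k"
      by (simp add: power2_eq_square)
    finally show ?thesis using assms(3) by (simp add: has_real_derivative_iff_has_vector_derivative)
  qed
  from fundamental_theorem_of_calculus[OF assms(2) this]
  show ?thesis by (intro integral_unique) (simp add: right_diff_distrib diff_divide_distrib)
qed

lemma poly_spline:
  assumes "degree p \<le> 3"
  shows "poly p \<in> cubic_splines_C1 n x"
proof -
  have "C1_on_interval (x 0) (x n) (poly p)" unfolding C1_on_interval_def
    by (rule exI[of _ "poly (pderiv p)"])
       (auto intro!: poly_DERIV has_field_derivative_at_within continuous_intros)
  thus ?thesis using assms by (auto simp: cubic_splines_C1_def)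
qed

section \<open>A single cell\<close>

text \<open>Moments of order 2 and 3, about the right end, of a cell of length \<open>h\<close> with state \<open>(p, v)\<close>
  at its left end: \<open>f \<mapsto> (\<integral>f) + p * f - v * f'\<close> is applied to powers of the distance to the right
  end.\<close>

definition mom2 :: "real \<Rightarrow> real \<Rightarrow> real \<Rightarrow> real" where
  "mom2 h p v = h ^ 3 / 3 + p * h ^ 2 + 2 * v * h"

definition mom3 :: "real \<Rightarrow> real \<Rightarrow> real \<Rightarrow> real" where
  "mom3 h p v = h ^ 4 / 4 + p * h ^ 3 + 3 * v * h ^ 2"

lemma mom_pos:
  assumes "h > 0" "p \<ge> 0" "v \<ge> 0"
  shows "mom2 h p v > 0" "mom3 h p v > 0"
  unfolding mom2_def mom3_def using assms
  by (auto intro!: add_pos_nonneg)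

text \<open>A single weighted node is recovered from two of its moments: their quotient is its
  distance, and the weight follows.\<close>

lemma mom_solve:
  assumes "w * y ^ 2 = m2" "w * y ^ 3 = m3" "m2 > 0" "m3 > (0::real)"
  shows "w > 0" "y > 0" "y = m3 / m2" "w = m2 ^ 3 / m3 ^ 2"
proof -
  show w: "w > 0"
    using assms(1,3) by (metis mult_nonpos_nonneg not_less zero_le_power2)
  have y: "m3 = y * m2"
    unfolding assms(1,2)[symmetric] by (simp add: power2_eq_square power3_eq_cube)
  show "y > 0" using assms(3,4) unfolding y by (simp add: zero_less_mult_iff)
  hence "m2 ^ 3 / m3 ^ 2 = w * ((w ^ 2 * y ^ 6) / (w ^ 2 * y ^ 6))"
    unfolding assms(1,2)[symmetric] by (simp add: power_def)
  also have "\<dots> = w" using w \<open>y > 0\<close> by simp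
  finally show "w = m2 ^ 3 / m3 ^ 2" by simp
  show "y = m3 / m2" using y assms(3) by simp
qed

text \<open>In terms of the defect \<open>d = h ^ 2 / 12 - v\<close>, the cell replaces
  \<open>d\<close> by \<open>d ^ 2 / m\<close>, which is at most \<open>d / 3\<close>. This keeps
  the state in the admissible region and makes \<open>v\<close> grow when
  \<open>d > 0\<close>.\<close>

lemma one_node_step:
  assumes h: "h > 0" and p: "p \<ge> 0" and v: "v \<ge> 0" "v \<le> h ^ 2 / 12"
    and w2: "w * y ^ 2 = mom2 h p v" and w3: "w * y ^ 3 = mom3 h p v"
  shows "w > 0" "y > 0" "p + h - w > 0" "v + p * h + h ^ 2 / 2 - w * y > 0"
    "v + p * h + h ^ 2 / 2 - w * y \<le> h ^ 2 / 12"
    "v < h ^ 2 / 12 \<Longrightarrow> y < h"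
    "v < h ^ 2 / 12 \<Longrightarrow> v + p * h + h ^ 2 / 2 - w * y < h ^ 2 / 12"
    "v < h ^ 2 / 12 \<Longrightarrow> v < v + p * h + h ^ 2 / 2 - w * y"
proof -
  note sol = mom_solve[OF w2 w3 mom_pos[OF h p v(1)]]
  show "w > 0" "y > 0" by fact+
  define d where "d = h ^ 2 / 12 - v"
  \<comment> \<open>Chosen so that \<open>mom2 h p v = h * (m + d)\<close> and
    \<open>mom3 h p v = h ^ 2 * m\<close>.\<close>
  define m where "m = h ^ 2 / 2 + p * h - 3 * d"
  define e where "e = d ^ 2 / m"
  have d: "0 \<le> d" "d \<le> h ^ 2 / 12" using v by (auto simp: d_def)
  have "h ^ 2 > 0" "p * h \<ge> 0" using h p by auto
  hence m: "m \<ge> 3 * d" "m > 0" "m \<ge> h ^ 2 / 4" using d unfolding m_def by linarith+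
  have M2: "mom2 h p v = h * (m + d)" and M3: "mom3 h p v = h ^ 2 * m"
    by (simp_all add: mom2_def mom3_def m_def d_def algebra_simps power2_eq_square
        power3_eq_cube power4_eq_xxxx)
  have y: "y = h * m / (m + d)" unfolding sol(3) M2 M3 using h
    by (simp add: power2_eq_square)
  have w: "w = (m + d) ^ 3 / (h * m ^ 2)" unfolding sol(4) M2 M3 using h
    by (simp add: power_def)
  have wy: "w * y = m + 2 * d + e"
  proof -
    have "w * y = (m + d) ^ 2 / m" if "m + d \<noteq> 0"
      unfolding w y using h m(2) that by (simp add: power2_eq_square power3_eq_cube)
    thus ?thesis using m d by (simp add: e_def field_simps power2_eq_square)
  qed
  have hw: "h * w = m + 3 * d + 3 * e + d / m * e"
    unfolding w e_def using h m(2) by (simp add: field_simps power2_eq_square power3_eq_cube)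
  have e: "0 \<le> e" "e \<le> d / 3"
  proof -
    show "0 \<le> e" using m d by (simp add: e_def)
    have "d * d \<le> d * (m / 3)" using d m by (intro mult_left_mono) auto
    thus "e \<le> d / 3" using m by (simp add: e_def power2_eq_square field_simps)
  qed
  have V: "v + p * h + h ^ 2 / 2 - w * y = h ^ 2 / 12 - e"
    unfolding wy by (simp add: d_def m_def)
  have "d / m \<le> 1" using m d by simp
  hence "d / m * e \<le> e" using e by (intro mult_left_le_one_le) (use d m in auto)
  moreover have "h * (p + h - w) = p * h + h ^ 2 - h * w"
    by (simp add: algebra_simps power2_eq_square)
  \<comment> \<open>Here \<open>m + 3 * d = h ^ 2 / 2 + p * h\<close>, and the other terms of
    \<open>h * w\<close> are at most \<open>4 * e \<le> h ^ 2 / 9\<close>.\<close>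
  ultimately have "h * (p + h - w) > 0"
    using hw e d \<open>h ^ 2 > 0\<close> m_def by linarith
  thus "p + h - w > 0" using h by (simp add: zero_less_mult_iff)
  show "v + p * h + h ^ 2 / 2 - w * y > 0" "v + p * h + h ^ 2 / 2 - w * y \<le> h ^ 2 / 12"
    unfolding V using e d \<open>h ^ 2 > 0\<close> by linarith+
  assume "v < h ^ 2 / 12"
  hence d0: "d > 0" by (simp add: d_def)
  show "y < h" unfolding y using d0 m h by (simp add: field_simps)
  have "e > 0" using d0 m by (simp add: e_def)
  show "v + p * h + h ^ 2 / 2 - w * y < h ^ 2 / 12" unfolding V using \<open>e > 0\<close> by simp
  have "e < d" using e d0 by linarith
  thus "v < v + p * h + h ^ 2 / 2 - w * y" unfolding V by (simp add: d_def)
qed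

text \<open>Divided by powers of \<open>h\<close>, the two equations are linear and independent in
  \<open>p * h\<close> and \<open>v\<close>, so an empty cell forces one particular state.\<close>

lemma no_node_step:
  assumes h: "h > 0" and "mom2 h p v = 0" "mom3 h p v = 0"
  shows "p = - h / 2" "v = h ^ 2 / 12"
proof -
  have "h * (h ^ 2 / 3 + p * h + 2 * v) = 0" "h ^ 2 * (h ^ 2 / 4 + p * h + 3 * v) = 0"
    using assms(2,3) by (simp_all add: mom2_def mom3_def algebra_simps power_def)
  hence *: "h ^ 2 / 3 + p * h + 2 * v = 0" "h ^ 2 / 4 + p * h + 3 * v = 0" using h by auto
  thus v: "v = h ^ 2 / 12" by simp
  have "h * (p + h / 2) = 0" using * by (simp add: algebra_simps power2_eq_square)
  thus "p = - h / 2" using h by auto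
qed

text \<open>Read from right to left, the cell leads from the state \<open>(- p', v')\<close> to
  \<open>(- p, v)\<close>, with \<open>h - y\<close> as the distance of the node.\<close>

lemma one_node_reflect:
  assumes "w * y ^ 2 = mom2 h p v" "w * y ^ 3 = mom3 h p v"
    and "p' = p + h - w" "v' = v + p * h + h ^ 2 / 2 - w * y"
  shows "w * (h - y) ^ 2 = mom2 h (- p') v'" "w * (h - y) ^ 3 = mom3 h (- p') v'"
    "- p = - p' + h - w" "v = v' + (- p') * h + h ^ 2 / 2 - w * (h - y)"
proof -
  have "w * (h - y) ^ 2 = w * h ^ 2 - 2 * h * (w * y) + w * y ^ 2"
    by (simp add: power2_eq_square algebra_simps)
  thus "w * (h - y) ^ 2 = mom2 h (- p') v'" unfolding assms(1) mom2_def assms(3,4)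
    by (simp add: algebra_simps power_def)
  have "w * (h - y) ^ 3 = w * h ^ 3 - 3 * h ^ 2 * (w * y) + 3 * h * (w * y ^ 2) - w * y ^ 3"
    by (simp add: power2_eq_square power3_eq_cube algebra_simps)
  thus "w * (h - y) ^ 3 = mom3 h (- p') v'" unfolding assms(1,2) mom2_def mom3_def assms(3,4)
    by (simp add: algebra_simps power_def)
  show "- p = - p' + h - w" unfolding assms(3) by simp
  show "v = v' + (- p') * h + h ^ 2 / 2 - w * (h - y)"
    unfolding assms(3,4) by (simp add: algebra_simps power2_eq_square)
qed

text \<open>This is the forward step for the reflected cell, whose initial state
  \<open>(- p', v')\<close> is nonnegative.\<close>

lemma one_node_backward:
  assumes h: "h > 0" and y: "0 < y" "y \<le> h"
    and w2: "w * y ^ 2 = mom2 h p v" and w3: "w * y ^ 3 = mom3 h p v"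
    and p': "p' = p + h - w" "p' \<le> 0" and v': "v' = v + p * h + h ^ 2 / 2 - w * y" "v' \<ge> 0"
  shows "w > 0" "p \<le> 0" "v \<ge> 0"
proof -
  note r = one_node_reflect[OF w2 w3 p'(1) v'(1)]
  have pos: "mom2 h (- p') v' > 0" "mom3 h (- p') v' > 0" using mom_pos[OF h _ v'(2), of "- p'"] p'(2) by simp_all
  note sol = mom_solve[OF r(1,2) pos]
  show "w > 0" by fact
  \<comment> \<open>The quotient of the reflected moments is \<open>h - y\<close>, which is below
    \<open>h\<close>; this amounts to \<open>v' \<le> h ^ 2 / 12\<close>.\<close>
  have "mom3 h (- p') v' \<le> h * mom2 h (- p') v'"
    using sol(3)[symmetric] y(1) pos(1) by (simp add: divide_eq_eq)
  moreover have "h * mom2 h (- p') v' - mom3 h (- p') v' = h ^ 2 * (h ^ 2 / 12 - v')"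
    by (simp add: mom2_def mom3_def algebra_simps power_def)
  ultimately have "h ^ 2 * (h ^ 2 / 12 - v') \<ge> 0" by linarith
  hence "v' \<le> h ^ 2 / 12" using h by (simp add: zero_le_mult_iff)
  note s = one_node_step[OF h _ v'(2) this r(1,2)]
  show "p \<le> 0" using s(3) p'(2) r(3) by linarith
  show "v \<ge> 0" using s(4) p'(2) r(4) by linarith
qed

section \<open>Cells with two nodes and comparison with the one-node cell\<close>

lemma two_node_weight_pos:
  fixes y1 y2 :: real
  assumes h: "h > 0" and y: "0 \<le> y2" "y2 \<le> h" "y1 \<noteq> y2"
    and p: "p \<ge> 0" "v \<ge> 0"
    and p': "p' = p + h - (w1 + w2)" "p' \<le> 0"
    and v': "v' = v + p * h + h ^ 2 / 2 - (w1 * y1 + w2 * y2)" "v' \<ge> 0"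
    and m2: "w1 * y1 ^ 2 + w2 * y2 ^ 2 = mom2 h p v"
  shows "w1 > 0"
proof -
  \<comment> \<open>The test function \<open>(y - y2) ^ 2\<close> removes the second node. What
    remains is its integral over the cell plus nonnegative boundary terms from both ends.\<close>
  have "w1 * (y1 - y2) ^ 2 = (w1 * y1 ^ 2 + w2 * y2 ^ 2) - 2 * y2 * (w1 * y1 + w2 * y2)
          + y2 ^ 2 * (w1 + w2)"
    by (simp add: algebra_simps power2_eq_square)
  also have "\<dots> = h * ((y2 - h / 2) ^ 2 + h ^ 2 / 12) + p * (h - y2) ^ 2 + 2 * v * (h - y2)
          + 2 * y2 * v' + y2 ^ 2 * (- p')"
    unfolding m2 mom2_def p'(1) v'(1) by (simp add: algebra_simps power_def)
  also have "\<dots> > 0"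
  proof -
    have "h * ((y2 - h / 2) ^ 2 + h ^ 2 / 12) > 0" using h
      by (intro mult_pos_pos add_nonneg_pos) auto
    moreover have "p * (h - y2) ^ 2 \<ge> 0" "2 * v * (h - y2) \<ge> 0" "2 * y2 * v' \<ge> 0" 
      using assms by auto
    moreover have "y2 ^ 2 * (- p') \<ge> 0" using p' by (intro mult_nonneg_nonneg) auto
    ultimately show ?thesis by linarith
  qed
  finally show ?thesis by (simp add: zero_less_mult_iff)
qed

text \<open>Both moment systems are tested with the cubic \<open>y (y - y0)\<^sup>2\<close>, which is nonnegative on the
  cell and vanishes to second order at the node \<open>y0\<close> of the one-node rule.\<close>

lemma comparison_identity:
  assumes "w0 * y0 ^ 2 = mom2 h p0 v0" "w0 * y0 ^ 3 = mom3 h p0 v0"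
    and "v0' = v0 + p0 * h + h ^ 2 / 2 - w0 * y0"
    and s2: "(\<Sum>i\<in>C. w i * y i ^ 2) = mom2 h p v" and s3: "(\<Sum>i\<in>C. w i * y i ^ 3) = mom3 h p v"
    and v': "v' = v + p * h + h ^ 2 / 2 - (\<Sum>i\<in>C. w i * y i)"
  shows "y0 ^ 2 * (v0' - v') = (\<Sum>i\<in>C. w i * (y i * (y i - y0) ^ 2))
           + (p0 - p) * (h * (h - y0) ^ 2) + (v0 - v) * ((3 * h - y0) * (h - y0))"
proof -
  have "(\<Sum>i\<in>C. w i * (y i * (y i - y0) ^ 2)) =
     (\<Sum>i\<in>C. w i * y i ^ 3) - 2 * y0 * (\<Sum>i\<in>C. w i * y i ^ 2) + y0 ^ 2 * (\<Sum>i\<in>C. w i * y i)"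
    by (simp add: sum_distrib_left sum_subtractf [symmetric] sum.distrib [symmetric])
       (rule sum.cong, simp_all add: algebra_simps power2_eq_square power3_eq_cube)
  also have "\<dots> = mom3 h p v - 2 * y0 * mom2 h p v + y0 ^ 2 * (v + p * h + h ^ 2 / 2 - v')"
    using s2 s3 v' by simp
  finally have 1: "(\<Sum>i\<in>C. w i * (y i * (y i - y0) ^ 2)) = \<dots>" .
  have "mom3 h p0 v0 - 2 * y0 * mom2 h p0 v0 + y0 ^ 2 * (v0 + p0 * h + h ^ 2 / 2 - v0') = 0"
    unfolding assms(1-2)[symmetric] assms(3) by (simp add: algebra_simps power_def)
  with 1 show ?thesis by (simp add: algebra_simps power_def mom2_def mom3_def)
qed

text \<open>All three terms of the identity are nonnegative, as \<open>y0 < h\<close>; a smaller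
  \<open>v\<close> or a node off \<open>y0\<close> makes one of them positive.\<close>

lemma comparison_less:
  assumes "w0 * y0 ^ 2 = mom2 h p0 v0" "w0 * y0 ^ 3 = mom3 h p0 v0"
    and "v0' = v0 + p0 * h + h ^ 2 / 2 - w0 * y0"
    and "(\<Sum>i\<in>C. w i * y i ^ 2) = mom2 h p v" "(\<Sum>i\<in>C. w i * y i ^ 3) = mom3 h p v"
    and "v' = v + p * h + h ^ 2 / 2 - (\<Sum>i\<in>C. w i * y i)"
    and y0: "0 < y0" "y0 < h" and fin: "finite C"
    and pos: "\<And>i. i \<in> C \<Longrightarrow> w i > 0" "\<And>i. i \<in> C \<Longrightarrow> y i > 0"
    and le: "p \<le> p0" "v \<le> v0" and strict: "v < v0 \<or> (\<exists>i\<in>C. y i \<noteq> y0)"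
  shows "v' < v0'"
proof -
  note id = comparison_identity[OF assms(1-6)]
  have nonneg: "w i * (y i * (y i - y0) ^ 2) \<ge> 0" if "i \<in> C" for i
    using pos[OF that] by simp
  hence 1: "(\<Sum>i\<in>C. w i * (y i * (y i - y0) ^ 2)) \<ge> 0" by (rule sum_nonneg)
  have h: "(3 * h - y0) * (h - y0) > 0" using y0 by simp
  have 2: "(v0 - v) * ((3 * h - y0) * (h - y0)) \<ge> 0" using le h by simp
  have 3: "(p0 - p) * (h * (h - y0) ^ 2) \<ge> 0" using le y0 by simp
  from strict have "y0 ^ 2 * (v0' - v') > 0"
  proof
    assume "v < v0"
    hence "(v0 - v) * ((3 * h - y0) * (h - y0)) > 0" using h by simp
    thus ?thesis unfolding id using 1 3 by linarith
  next
    assume "\<exists>i\<in>C. y i \<noteq> y0"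
    then obtain i where i: "i \<in> C" "y i \<noteq> y0" by blast
    have "w i * (y i * (y i - y0) ^ 2) > 0" using i pos[OF i(1)] by simp
    hence "(\<Sum>i\<in>C. w i * (y i * (y i - y0) ^ 2)) > 0"
      using nonneg i fin by (intro sum_pos2[of C i]) auto
    thus ?thesis unfolding id using 2 3 by linarith
  qed
  thus ?thesis by (simp add: zero_less_mult_iff)
qed

text \<open>The state of the rule with one node per cell: it integrates \<open>f\<close> over \<open>{x 0..x j}\<close> up to
  the error \<open>p * f (x j) - v * f' (x j)\<close>, where \<open>(p, v) = ideal x j\<close>.\<close>

primrec ideal :: "(nat \<Rightarrow> real) \<Rightarrow> nat \<Rightarrow> real \<times> real" where
  "ideal x 0 = (0, 0)"
| "ideal x (Suc j) =
     (let (p, v) = ideal x j; h = x (Suc j) - x j; m2 = mom2 h p v; m3 = mom3 h p v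
      in (p + h - m2 ^ 3 / m3 ^ 2, v + p * h + h ^ 2 / 2 - m2 ^ 2 / m3))"

definition ideal_p :: "(nat \<Rightarrow> real) \<Rightarrow> nat \<Rightarrow> real" where "ideal_p x j = fst (ideal x j)"
definition ideal_v :: "(nat \<Rightarrow> real) \<Rightarrow> nat \<Rightarrow> real" where "ideal_v x j = snd (ideal x j)"

lemma ideal_0 [simp]: "ideal_p x 0 = 0" "ideal_v x 0 = 0"
  by (simp_all add: ideal_p_def ideal_v_def)

text \<open>The recursion is written with quotients of moments, which stand for \<open>w\<close> and
  \<open>w * y\<close>; this translates it back.\<close>

lemma ideal_Suc:
  assumes "w * y ^ 2 = mom2 (x (Suc j) - x j) (ideal_p x j) (ideal_v x j)"
    and "w * y ^ 3 = mom3 (x (Suc j) - x j) (ideal_p x j) (ideal_v x j)"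
    and "w > 0" "y > 0"
  shows "ideal_p x (Suc j) = ideal_p x j + (x (Suc j) - x j) - w"
    "ideal_v x (Suc j) = ideal_v x j + ideal_p x j * (x (Suc j) - x j)
       + (x (Suc j) - x j) ^ 2 / 2 - w * y"
proof -
  have "(w * y ^ 2) ^ 3 / (w * y ^ 3) ^ 2 = w" "(w * y ^ 2) ^ 2 / (w * y ^ 3) = w * y"
    using assms(3,4) by (simp_all add: power_def)
  thus "ideal_p x (Suc j) = ideal_p x j + (x (Suc j) - x j) - w"
    "ideal_v x (Suc j) = ideal_v x j + ideal_p x j * (x (Suc j) - x j)
       + (x (Suc j) - x j) ^ 2 / 2 - w * y"
    unfolding assms(1,2) by (simp_all add: ideal_p_def ideal_v_def Let_def case_prod_unfold)
qed

section \<open>The increasing half of the partition\<close>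

locale stretched_knots =
  fixes x :: "nat \<Rightarrow> real" and M :: nat
  assumes x_less: "j < M \<Longrightarrow> x j < x (Suc j)"
    and stretched: "Suc j < M \<Longrightarrow> x (Suc j) - x j \<le> x (Suc (Suc j)) - x (Suc j)"
begin

text \<open>The two claims support each other: a state in the region admits a one-node step, whose
  result lies in the region of the next cell.\<close>

lemma ideal_bounds:
  "j < M \<Longrightarrow> 0 \<le> ideal_p x j \<and> 0 \<le> ideal_v x j \<and> ideal_v x j < (x (Suc j) - x j) ^ 2 / 12"
  and ideal_step_exists:
  "j < M \<Longrightarrow> \<exists>w y. w * y ^ 2 = mom2 (x (Suc j) - x j) (ideal_p x j) (ideal_v x j) \<and>
     w * y ^ 3 = mom3 (x (Suc j) - x j) (ideal_p x j) (ideal_v x j) \<and>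
     0 < w \<and> 0 < y \<and> y < x (Suc j) - x j \<and> 0 < ideal_p x (Suc j) \<and>
     ideal_v x j < ideal_v x (Suc j) \<and> ideal_v x (Suc j) < (x (Suc j) - x j) ^ 2 / 12"
proof -
  have step: "\<exists>w y. w * y ^ 2 = mom2 (x (Suc j) - x j) (ideal_p x j) (ideal_v x j) \<and>
     w * y ^ 3 = mom3 (x (Suc j) - x j) (ideal_p x j) (ideal_v x j) \<and>
     0 < w \<and> 0 < y \<and> y < x (Suc j) - x j \<and> 0 < ideal_p x (Suc j) \<and>
     ideal_v x j < ideal_v x (Suc j) \<and> ideal_v x (Suc j) < (x (Suc j) - x j) ^ 2 / 12"
    if j: "j < M" and b: "0 \<le> ideal_p x j" "0 \<le> ideal_v x j"
      "ideal_v x j < (x (Suc j) - x j) ^ 2 / 12" for j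
  proof -
    define h where "h = x (Suc j) - x j"
    have h: "h > 0" using x_less[OF j] by (simp add: h_def)
    define m2 where "m2 = mom2 h (ideal_p x j) (ideal_v x j)"
    define m3 where "m3 = mom3 h (ideal_p x j) (ideal_v x j)"
    define w where "w = m2 ^ 3 / m3 ^ 2"
    define y where "y = m3 / m2"
    have m: "m2 > 0" "m3 > 0" using mom_pos[OF h b(1,2)] by (simp_all add: m2_def m3_def)
    have "w * y ^ 2 = m2" "w * y ^ 3 = m3" using m by (simp_all add: w_def y_def power_def)
    note e = this[unfolded m2_def m3_def]
    have v: "ideal_v x j < h ^ 2 / 12" using b(3) by (simp add: h_def)
    note s = one_node_step[OF h b(1,2) less_imp_le[OF v] e]
    note I = ideal_Suc[OF e[unfolded h_def] s(1,2), folded h_def]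
    show ?thesis unfolding h_def[symmetric] I
      by (rule exI[of _ w], rule exI[of _ y], intro conjI) (use e s v in auto)
  qed
  have bounds: "0 \<le> ideal_p x j \<and> 0 \<le> ideal_v x j \<and> ideal_v x j < (x (Suc j) - x j) ^ 2 / 12"
    if "j < M" for j using that
  proof (induction j)
    case 0
    thus ?case using x_less[of 0] by simp
  next
    case (Suc j)
    hence "j < M" by simp
    with Suc step[of j] have s: "0 < ideal_p x (Suc j)" "ideal_v x j < ideal_v x (Suc j)"
       "ideal_v x (Suc j) < (x (Suc j) - x j) ^ 2 / 12" "0 \<le> ideal_v x j" by auto
    \<comment> \<open>The bound obtained is relative to the old cell; the next cell is at least as
      long.\<close>
    have "(x (Suc j) - x j) ^ 2 \<le> (x (Suc (Suc j)) - x (Suc j)) ^ 2"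
      using stretched[OF Suc.prems] x_less[OF \<open>j < M\<close>] by (intro power_mono) auto
    thus ?case using s by simp
  qed
  show "j < M \<Longrightarrow> 0 \<le> ideal_p x j \<and> 0 \<le> ideal_v x j \<and> ideal_v x j < (x (Suc j) - x j) ^ 2 / 12"
    by (rule bounds)
  show "j < M \<Longrightarrow> \<exists>w y. w * y ^ 2 = mom2 (x (Suc j) - x j) (ideal_p x j) (ideal_v x j) \<and>
     w * y ^ 3 = mom3 (x (Suc j) - x j) (ideal_p x j) (ideal_v x j) \<and>
     0 < w \<and> 0 < y \<and> y < x (Suc j) - x j \<and> 0 < ideal_p x (Suc j) \<and>
     ideal_v x j < ideal_v x (Suc j) \<and> ideal_v x (Suc j) < (x (Suc j) - x j) ^ 2 / 12"
    using step[of j] bounds[of j] by blast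
qed

lemma ideal_nonneg: "j \<le> M \<Longrightarrow> 0 \<le> ideal_p x j" "j \<le> M \<Longrightarrow> 0 \<le> ideal_v x j"
  using ideal_step_exists[of "j - 1"] ideal_bounds[of "j - 1"] by (cases j; force)+

lemma ideal_p_pos: "j \<le> M \<Longrightarrow> 0 < j \<Longrightarrow> 0 < ideal_p x j"
  using ideal_step_exists[of "j - 1"] by (cases j) auto

lemma ideal_v_less: "j < M \<Longrightarrow> ideal_v x j < ideal_v x (Suc j)"
  using ideal_step_exists by blast

end

section \<open>Moments of the cells of a quadrature rule\<close>

text \<open>The part of a quadrature rule that lies in the increasing half of the partition;
  \<open>exact2\<close> and \<open>exact3\<close> express exactness for the truncated powers \<open>(x j - t)\<^sub>+\<close>
  to the exponents 2 and 3.\<close>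

locale half_rule = stretched_knots +
  fixes I :: "nat set" and \<tau> \<omega> :: "nat \<Rightarrow> real"
  assumes finite_I: "finite I"
    and inj_nodes: "inj_on \<tau> I"
    and nodes_ge: "i \<in> I \<Longrightarrow> x 0 \<le> \<tau> i"
    and exact2: "j \<le> M \<Longrightarrow>
      (\<Sum>i | i \<in> I \<and> \<tau> i < x j. \<omega> i * (x j - \<tau> i) ^ 2) = (x j - x 0) ^ 3 / 3"
    and exact3: "j \<le> M \<Longrightarrow>
      (\<Sum>i | i \<in> I \<and> \<tau> i < x j. \<omega> i * (x j - \<tau> i) ^ 3) = (x j - x 0) ^ 4 / 4"
begin

definition "below j = {i \<in> I. \<tau> i < x j}"
definition "cell j = {i \<in> I. x j \<le> \<tau> i \<and> \<tau> i < x (Suc j)}"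
text \<open>Since the error is \<open>P * f (x j) - V * f' (x j)\<close>, these are the errors for
  \<open>f = 1\<close> and for \<open>f t = x j - t\<close>.\<close>

definition "P j = x j - x 0 - (\<Sum>i\<in>below j. \<omega> i)"
definition "V j = (x j - x 0) ^ 2 / 2 - (\<Sum>i\<in>below j. \<omega> i * (x j - \<tau> i))"

lemma finite_below [simp]: "finite (below j)" and finite_cell [simp]: "finite (cell j)"
  using finite_I by (auto simp: below_def cell_def)

lemma below_0 [simp]: "below 0 = {}"
  using nodes_ge by (force simp: below_def)

lemma P_0 [simp]: "P 0 = 0" and V_0 [simp]: "V 0 = 0"
  by (simp_all add: P_def V_def)

context
  fixes j assumes j: "j < M"
begin

lemma below_Suc: "below (Suc j) = below j \<union> cell j" "below j \<inter> cell j = {}"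
  using x_less[OF j] by (auto simp: below_def cell_def)

lemma card_below_Suc: "card (below (Suc j)) = card (below j) + card (cell j)"
  unfolding below_Suc(1) by (rule card_Un_disjoint) (use below_Suc in auto)

lemma sum_below_Suc: "sum f (below (Suc j)) = sum f (below j) + (sum f (cell j) :: real)"
  unfolding below_Suc(1) by (rule sum.union_disjoint) (use below_Suc in auto)

lemma P_Suc: "P (Suc j) = P j + (x (Suc j) - x j) - (\<Sum>i\<in>cell j. \<omega> i)"
  by (simp add: P_def sum_below_Suc)

lemma sum_below_shift:
  "(\<Sum>i\<in>below j. \<omega> i * (x (Suc j) - \<tau> i)) =
     (\<Sum>i\<in>below j. \<omega> i * (x j - \<tau> i)) + (x (Suc j) - x j) * (\<Sum>i\<in>below j. \<omega> i)"
  "(\<Sum>i\<in>below j. \<omega> i * (x (Suc j) - \<tau> i) ^ 2) =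
     (\<Sum>i\<in>below j. \<omega> i * (x j - \<tau> i) ^ 2)
     + 2 * (x (Suc j) - x j) * (\<Sum>i\<in>below j. \<omega> i * (x j - \<tau> i))
     + (x (Suc j) - x j) ^ 2 * (\<Sum>i\<in>below j. \<omega> i)"
  "(\<Sum>i\<in>below j. \<omega> i * (x (Suc j) - \<tau> i) ^ 3) =
     (\<Sum>i\<in>below j. \<omega> i * (x j - \<tau> i) ^ 3)
     + 3 * (x (Suc j) - x j) * (\<Sum>i\<in>below j. \<omega> i * (x j - \<tau> i) ^ 2)
     + 3 * (x (Suc j) - x j) ^ 2 * (\<Sum>i\<in>below j. \<omega> i * (x j - \<tau> i))
     + (x (Suc j) - x j) ^ 3 * (\<Sum>i\<in>below j. \<omega> i)"
  by (simp_all add: sum_distrib_left flip: sum.distrib)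
     (rule sum.cong, simp_all add: algebra_simps power2_eq_square power3_eq_cube)+

lemma V_Suc: "V (Suc j) = V j + P j * (x (Suc j) - x j) + (x (Suc j) - x j) ^ 2 / 2
    - (\<Sum>i\<in>cell j. \<omega> i * (x (Suc j) - \<tau> i))"
  unfolding V_def P_def sum_below_Suc sum_below_shift
  by (simp add: field_simps power2_eq_square)

text \<open>Exactness at the right end minus exactness at the left end of the cell. After expansion
  about \<open>x j\<close>, the old nodes enter through their moments of order 0 and 1, which
  \<open>P j\<close> and \<open>V j\<close> encode.\<close>

lemma cell_mom2:
  "(\<Sum>i\<in>cell j. \<omega> i * (x (Suc j) - \<tau> i) ^ 2) = mom2 (x (Suc j) - x j) (P j) (V j)"
proof -
  have "(\<Sum>i\<in>below j. \<omega> i * (x j - \<tau> i) ^ 2) = (x j - x 0) ^ 3 / 3"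
    "(\<Sum>i\<in>below (Suc j). \<omega> i * (x (Suc j) - \<tau> i) ^ 2) = (x (Suc j) - x 0) ^ 3 / 3"
    using exact2[of j] exact2[of "Suc j"] j by (simp_all add: below_def)
  hence "(\<Sum>i\<in>cell j. \<omega> i * (x (Suc j) - \<tau> i) ^ 2) = (x (Suc j) - x 0) ^ 3 / 3
     - ((x j - x 0) ^ 3 / 3 + 2 * (x (Suc j) - x j) * (\<Sum>i\<in>below j. \<omega> i * (x j - \<tau> i))
     + (x (Suc j) - x j) ^ 2 * (\<Sum>i\<in>below j. \<omega> i))"
    unfolding sum_below_Suc sum_below_shift by linarith
  moreover define S0 S1 where "S0 = (\<Sum>i\<in>below j. \<omega> i)"
    and "S1 = (\<Sum>i\<in>below j. \<omega> i * (x j - \<tau> i))"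
  ultimately show ?thesis unfolding mom2_def P_def V_def S0_def[symmetric] S1_def[symmetric]
    by (simp only:) (simp add: field_simps power2_eq_square power3_eq_cube power4_eq_xxxx)
qed

text \<open>As for order 2, but the second moment of the old nodes occurs as well;
  \<open>exact2\<close> supplies it.\<close>

lemma cell_mom3:
  "(\<Sum>i\<in>cell j. \<omega> i * (x (Suc j) - \<tau> i) ^ 3) = mom3 (x (Suc j) - x j) (P j) (V j)"
proof -
  have e: "(\<Sum>i\<in>below j. \<omega> i * (x j - \<tau> i) ^ 3) = (x j - x 0) ^ 4 / 4"
    "(\<Sum>i\<in>below j. \<omega> i * (x j - \<tau> i) ^ 2) = (x j - x 0) ^ 3 / 3"
    and "(\<Sum>i\<in>below (Suc j). \<omega> i * (x (Suc j) - \<tau> i) ^ 3) = (x (Suc j) - x 0) ^ 4 / 4"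
    using exact2[of j] exact3[of j] exact3[of "Suc j"] j by (simp_all add: below_def)
  from this(3) have "(\<Sum>i\<in>cell j. \<omega> i * (x (Suc j) - \<tau> i) ^ 3) = (x (Suc j) - x 0) ^ 4 / 4
     - ((x j - x 0) ^ 4 / 4 + 3 * (x (Suc j) - x j) * ((x j - x 0) ^ 3 / 3)
     + 3 * (x (Suc j) - x j) ^ 2 * (\<Sum>i\<in>below j. \<omega> i * (x j - \<tau> i))
     + (x (Suc j) - x j) ^ 3 * (\<Sum>i\<in>below j. \<omega> i))"
    unfolding sum_below_Suc sum_below_shift e by linarith
  moreover define S0 S1 where "S0 = (\<Sum>i\<in>below j. \<omega> i)"
    and "S1 = (\<Sum>i\<in>below j. \<omega> i * (x j - \<tau> i))"
  ultimately show ?thesis unfolding mom3_def P_def V_def S0_def[symmetric] S1_def[symmetric]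
    by (simp only:) (simp add: field_simps power2_eq_square power3_eq_cube power4_eq_xxxx)
qed

end

section \<open>Surplus of nodes and the possible states\<close>

text \<open>The alternatives for the state at \<open>x j\<close>, by the surplus of nodes over cells so far: none,
  so the rule is the one-node rule; exactly one, gained in a single cell; at least one, but the
  state was made admissible again by an empty cell. In the remaining case the surplus is at
  least two.\<close>

definition "ideal_upto j \<longleftrightarrow>
  (\<forall>i\<le>j. card (below i) = i \<and> P i = ideal_p x i \<and> V i = ideal_v x i)"

definition "surplus_one j \<longleftrightarrow>
  card (below j) = Suc j \<and> (P j \<le> 0 \<and> 0 \<le> V j \<longrightarrow> V j < ideal_v x j)"

definition "after_reset j \<longleftrightarrow>
  Suc j \<le> card (below j) \<and> 0 < P j \<and> 0 \<le> V j \<and> V j \<le> (x j - x (j - 1)) ^ 2 / 12"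

text \<open>Both moments vanish, which fixes the state. Crossing the cell adds its length to
  \<open>P\<close>, which reverses the sign of \<open>P\<close> and leaves \<open>V\<close>
  unchanged.\<close>

lemma empty_cell:
  assumes j: "j < M" and c: "cell j = {}"
  shows "P j = - (x (Suc j) - x j) / 2" "V j = (x (Suc j) - x j) ^ 2 / 12"
    "P (Suc j) = (x (Suc j) - x j) / 2" "V (Suc j) = (x (Suc j) - x j) ^ 2 / 12"
proof -
  have h: "x (Suc j) - x j > 0" using x_less[OF j] by simp
  have "mom2 (x (Suc j) - x j) (P j) (V j) = 0" "mom3 (x (Suc j) - x j) (P j) (V j) = 0"
    using cell_mom2[OF j] cell_mom3[OF j] c by simp_all
  note n = no_node_step[OF h this]
  show "P j = - (x (Suc j) - x j) / 2" "V j = (x (Suc j) - x j) ^ 2 / 12" by fact+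
  show "P (Suc j) = (x (Suc j) - x j) / 2" unfolding P_Suc[OF j] n(1) c by (simp add: field_simps)
  show "V (Suc j) = (x (Suc j) - x j) ^ 2 / 12" unfolding V_Suc[OF j] n(1,2) c
    by (simp add: field_simps power2_eq_square)
qed

lemma ideal_upto_Suc:
  assumes j: "j < M" and J: "ideal_upto j" and c: "cell j = {i}"
  shows "ideal_upto (Suc j)" "0 < \<omega> i"
    "\<omega> i * (x (Suc j) - \<tau> i) ^ 2 = mom2 (x (Suc j) - x j) (P j) (V j)"
    "\<omega> i * (x (Suc j) - \<tau> i) ^ 3 = mom3 (x (Suc j) - x j) (P j) (V j)"
    "P (Suc j) = P j + (x (Suc j) - x j) - \<omega> i"
    "V (Suc j) = V j + P j * (x (Suc j) - x j) + (x (Suc j) - x j) ^ 2 / 2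
       - \<omega> i * (x (Suc j) - \<tau> i)"
proof -
  have h: "x (Suc j) - x j > 0" using x_less[OF j] by simp
  have PV: "P j = ideal_p x j" "V j = ideal_v x j" using J by (auto simp: ideal_upto_def)
  show m: "\<omega> i * (x (Suc j) - \<tau> i) ^ 2 = mom2 (x (Suc j) - x j) (P j) (V j)"
    "\<omega> i * (x (Suc j) - \<tau> i) ^ 3 = mom3 (x (Suc j) - x j) (P j) (V j)"
    using cell_mom2[OF j] cell_mom3[OF j] c by simp_all
  have b: "0 \<le> P j" "0 \<le> V j" "V j \<le> (x (Suc j) - x j) ^ 2 / 12"
    using ideal_bounds[OF j] PV by auto
  note s = one_node_step(1,2)[OF h b m]
  show "0 < \<omega> i" by fact
  show S: "P (Suc j) = P j + (x (Suc j) - x j) - \<omega> i"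
    "V (Suc j) = V j + P j * (x (Suc j) - x j) + (x (Suc j) - x j) ^ 2 / 2
       - \<omega> i * (x (Suc j) - \<tau> i)"
    using P_Suc[OF j] V_Suc[OF j] c by simp_all
  have "P (Suc j) = ideal_p x (Suc j)" "V (Suc j) = ideal_v x (Suc j)"
    using S ideal_Suc[OF m[unfolded PV] s] PV by simp_all
  moreover have "card (below (Suc j)) = Suc j"
    using card_below_Suc[OF j] J c by (simp add: ideal_upto_def)
  ultimately show "ideal_upto (Suc j)"
    using J by (auto simp: ideal_upto_def le_Suc_eq)
qed

lemma after_reset_bound:
  assumes "j < M" "after_reset j"
  shows "V j \<le> (x (Suc j) - x j) ^ 2 / 12"
proof (cases j)
  case 0
  \<comment> \<open>At \<open>0\<close> the assumption is contradictory, because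
    \<open>below 0\<close> is empty.\<close>
  thus ?thesis using assms by (simp add: after_reset_def)
next
  case (Suc k)
  have "(x j - x (j - 1)) ^ 2 \<le> (x (Suc j) - x j) ^ 2"
    using stretched[of k] x_less[of k] Suc assms(1) by (intro power_mono) auto
  thus ?thesis using assms(2) by (simp add: after_reset_def)
qed

text \<open>The forward step needs only an admissible state, whatever its origin.\<close>

lemma after_reset_Suc:
  assumes j: "j < M" and J: "after_reset j" and c: "cell j = {i}"
  shows "after_reset (Suc j)"
proof -
  have h: "x (Suc j) - x j > 0" using x_less[OF j] by simp
  have m: "\<omega> i * (x (Suc j) - \<tau> i) ^ 2 = mom2 (x (Suc j) - x j) (P j) (V j)"
    "\<omega> i * (x (Suc j) - \<tau> i) ^ 3 = mom3 (x (Suc j) - x j) (P j) (V j)"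
    using cell_mom2[OF j] cell_mom3[OF j] c by simp_all
  have b: "0 \<le> P j" "0 \<le> V j" using J by (auto simp: after_reset_def)
  note s = one_node_step[OF h b after_reset_bound[OF j J] m]
  have S: "P (Suc j) = P j + (x (Suc j) - x j) - \<omega> i"
    "V (Suc j) = V j + P j * (x (Suc j) - x j) + (x (Suc j) - x j) ^ 2 / 2
       - \<omega> i * (x (Suc j) - \<tau> i)"
    using P_Suc[OF j] V_Suc[OF j] c by simp_all
  show ?thesis unfolding after_reset_def
    using s(3-5)[folded S] card_below_Suc[OF j] J c by (simp add: after_reset_def)
qed

text \<open>The premise on \<open>P\<close> and \<open>V\<close> is imposed at the right end;
  \<open>one_node_backward\<close> carries it to the left end, where the hypothesis gives a deficit
  in \<open>V\<close>. Comparison with the ideal cell preserves the deficit.\<close>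

lemma surplus_one_Suc:
  assumes j: "j < M" and J: "surplus_one j" and c: "cell j = {i}"
  shows "surplus_one (Suc j)"
  unfolding surplus_one_def
proof (intro conjI impI)
  show "card (below (Suc j)) = Suc (Suc j)"
    using card_below_Suc[OF j] J c by (simp add: surplus_one_def)
  assume PV': "P (Suc j) \<le> 0 \<and> 0 \<le> V (Suc j)"
  have h: "x (Suc j) - x j > 0" using x_less[OF j] by simp
  have m: "\<omega> i * (x (Suc j) - \<tau> i) ^ 2 = mom2 (x (Suc j) - x j) (P j) (V j)"
    "\<omega> i * (x (Suc j) - \<tau> i) ^ 3 = mom3 (x (Suc j) - x j) (P j) (V j)"
    using cell_mom2[OF j] cell_mom3[OF j] c by simp_all
  have S: "P (Suc j) = P j + (x (Suc j) - x j) - \<omega> i"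
    "V (Suc j) = V j + P j * (x (Suc j) - x j) + (x (Suc j) - x j) ^ 2 / 2
       - \<omega> i * (x (Suc j) - \<tau> i)"
    using P_Suc[OF j] V_Suc[OF j] c by simp_all
  have i: "0 < x (Suc j) - \<tau> i" "x (Suc j) - \<tau> i \<le> x (Suc j) - x j"
    using c by (auto simp: cell_def)
  have b: "\<omega> i > 0" "P j \<le> 0" "0 \<le> V j"
    using one_node_backward[OF h i m S(1) _ S(2)] PV' by auto
  hence V: "V j < ideal_v x j" using J by (auto simp: surplus_one_def)
  from ideal_step_exists[OF j] obtain w y where
    wy: "w * y ^ 2 = mom2 (x (Suc j) - x j) (ideal_p x j) (ideal_v x j)"
    "w * y ^ 3 = mom3 (x (Suc j) - x j) (ideal_p x j) (ideal_v x j)"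
    "0 < w" "0 < y" "y < x (Suc j) - x j" by blast
  show "V (Suc j) < ideal_v x (Suc j)"
    by (rule comparison_less[OF wy(1,2) ideal_Suc(2)[OF wy(1-4)] cell_mom2[OF j] cell_mom3[OF j]
          V_Suc[OF j] wy(4,5)])
      (use b V c i ideal_bounds[OF j] in auto)
qed

text \<open>The cell starts in the ideal state, so the deficit must come from its nodes: the weights
  are positive, and two distinct nodes cannot both be at the ideal distance
  \<open>y0\<close>.\<close>

lemma surplus_one_start:
  assumes j: "j < M" and J: "ideal_upto j" and c: "card (cell j) = 2"
  shows "surplus_one (Suc j)"
  unfolding surplus_one_def
proof (intro conjI impI)
  show "card (below (Suc j)) = Suc (Suc j)"
    using card_below_Suc[OF j] J c by (simp add: ideal_upto_def)
  assume PV': "P (Suc j) \<le> 0 \<and> 0 \<le> V (Suc j)"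
  have h: "x (Suc j) - x j > 0" using x_less[OF j] by simp
  from c obtain i k where ik: "cell j = {i, k}" "i \<noteq> k" by (auto simp: card_2_iff)
  define y where "y i = x (Suc j) - \<tau> i" for i
  have ran: "0 < y l" "y l \<le> x (Suc j) - x j" if "l \<in> cell j" for l
    using that by (auto simp: cell_def y_def)
  have PV: "P j = ideal_p x j" "V j = ideal_v x j" using J by (auto simp: ideal_upto_def)
  have b: "0 \<le> P j" "0 \<le> V j" using ideal_bounds[OF j] PV by auto
  have m: "\<omega> i * y i ^ 2 + \<omega> k * y k ^ 2 = mom2 (x (Suc j) - x j) (P j) (V j)"
    using cell_mom2[OF j] ik by (simp add: y_def)
  have S: "P (Suc j) = P j + (x (Suc j) - x j) - (\<omega> i + \<omega> k)"
    "V (Suc j) = V j + P j * (x (Suc j) - x j) + (x (Suc j) - x j) ^ 2 / 2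
       - (\<omega> i * y i + \<omega> k * y k)"
    using P_Suc[OF j] V_Suc[OF j] ik by (simp_all add: y_def)
  have "\<tau> i \<noteq> \<tau> k"
    using inj_onD[OF inj_nodes, of i k] ik by (auto simp: cell_def)
  hence ne: "y i \<noteq> y k" "y k \<noteq> y i" by (auto simp: y_def)
  have m': "\<omega> k * y k ^ 2 + \<omega> i * y i ^ 2 = mom2 (x (Suc j) - x j) (P j) (V j)"
    and S': "P (Suc j) = P j + (x (Suc j) - x j) - (\<omega> k + \<omega> i)"
    "V (Suc j) = V j + P j * (x (Suc j) - x j) + (x (Suc j) - x j) ^ 2 / 2
       - (\<omega> k * y k + \<omega> i * y i)"
    using m S by (simp_all only: add.commute)
  have ik': "i \<in> cell j" "k \<in> cell j" using ik by auto
  have w: "\<omega> i > 0" "\<omega> k > 0"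
    using two_node_weight_pos[OF h less_imp_le[OF ran(1)[OF ik'(2)]] ran(2)[OF ik'(2)] ne(1) b
        S(1) conjunct1[OF PV'] S(2) conjunct2[OF PV'] m]
      two_node_weight_pos[OF h less_imp_le[OF ran(1)[OF ik'(1)]] ran(2)[OF ik'(1)] ne(2) b
        S'(1) conjunct1[OF PV'] S'(2) conjunct2[OF PV'] m'] .
  from ideal_step_exists[OF j] obtain w0 y0 where
    wy: "w0 * y0 ^ 2 = mom2 (x (Suc j) - x j) (ideal_p x j) (ideal_v x j)"
    "w0 * y0 ^ 3 = mom3 (x (Suc j) - x j) (ideal_p x j) (ideal_v x j)"
    "0 < w0" "0 < y0" "y0 < x (Suc j) - x j" by blast
  show "V (Suc j) < ideal_v x (Suc j)"
  proof (rule comparison_less[OF wy(1,2) ideal_Suc(2)[OF wy(1-4)] cell_mom2[OF j] cell_mom3[OF j]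
          V_Suc[OF j] wy(4,5)])
    show "V j < ideal_v x j \<or> (\<exists>l\<in>cell j. x (Suc j) - \<tau> l \<noteq> y0)"
      using ne ik' unfolding y_def by metis
  qed (use w ik ran PV in \<open>auto simp: y_def\<close>)
qed

text \<open>Induction, by the number of nodes in the new cell. An empty cell contradicts each of the
  first three alternatives; from the fourth it leads to \<open>after_reset\<close>. Cells with
  several nodes raise the surplus.\<close>

lemma states:
  "j \<le> M \<Longrightarrow> ideal_upto j \<or> surplus_one j \<or> after_reset j \<or> j + 2 \<le> card (below j)"
proof (induction j)
  case 0
  show ?case by (simp add: ideal_upto_def)
next
  case (Suc j)
  hence j: "j < M" by simp
  have h: "x (Suc j) - x j > 0" using x_less[OF j] by simp
  note cS = card_below_Suc[OF j]
  have "card (cell j) = 0 \<or> card (cell j) = 1 \<or> card (cell j) = 2 \<or> card (cell j) \<ge> 3" by linarith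
  then consider "cell j = {}" | i where "cell j = {i}" | "card (cell j) = 2" | "card (cell j) \<ge> 3"
    by (metis card_0_eq card_1_singletonE finite_cell)
  thus ?case
  proof cases
    case 1
    note e = empty_cell[OF j 1]
    consider "ideal_upto j" | "surplus_one j" | "after_reset j" | "j + 2 \<le> card (below j)"
      using Suc j by auto
    thus ?thesis
    proof cases
      case a: 1
      thus ?thesis using e(1) h ideal_bounds[OF j] by (auto simp: ideal_upto_def)
    next
      case a: 2
      \<comment> \<open>An empty cell meets the premise of \<open>surplus_one\<close>, but its
        \<open>V j\<close> exceeds the bound on \<open>ideal_v x j\<close>.\<close>
      thus ?thesis using e(1,2) h ideal_bounds[OF j] by (auto simp: surplus_one_def)
    next
      case a: 3
      thus ?thesis using e(1) h by (auto simp: after_reset_def)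
    next
      case a: 4
      \<comment> \<open>One node of the surplus is lost, and \<open>V\<close> lands exactly on the
        boundary of the admissible region.\<close>
      hence "after_reset (Suc j)"
        unfolding after_reset_def e(3,4) using h cS by simp
      thus ?thesis by simp
    qed
  next
    case 2
    thus ?thesis using Suc j ideal_upto_Suc[OF j _ 2] surplus_one_Suc[OF j _ 2] 
      after_reset_Suc[OF j _ 2] cS by auto
  next
    case 3
    thus ?thesis using Suc j surplus_one_start[OF j _ 3] cS 
      by (auto simp: surplus_one_def after_reset_def)
  next
    case 4
    thus ?thesis using Suc j cS 
      by (auto simp: surplus_one_def after_reset_def ideal_upto_def)
  qed
qed

end


section \<open>B-spline identities and the symmetric two-node cell\<close>

text \<open>The algebra behind \<open>coef_A\<close> and \<open>coef_B\<close>: the values of two neighbouring B-splines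
  at a node turn the moments of one cell into those of the next.\<close>

lemma coef_A_algebra:
  fixes h g p v w t :: real
  assumes "h > 0" "g > 0" "w * t ^ 2 = mom2 h p v" "w * t ^ 3 = mom3 h p v"
  shows "1 / 4 - w * (1 / (g ^ 2 * (g + h) ^ 2) * (t + g) ^ 3
           + (2 * g - h) / (h ^ 3 * g ^ 2) * t ^ 3 + - 3 / (h ^ 2 * g) * t ^ 2)
         = 1 / (g ^ 2 * (g + h) ^ 2) *
             mom3 g (p + h - w) (v + p * h + h ^ 2 / 2 - w * t)"
proof -
  have "1 / 4 - w * (a * (t + g) ^ 3 + b * t ^ 3 + c * t ^ 2) =
      a * mom3 g (p + h - w) (v + p * h + h ^ 2 / 2 - w * t)"
    \<comment> \<open>The claim is linear in the moments of the node, so only this identity in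
      \<open>h\<close>, \<open>g\<close>, \<open>p\<close>, \<open>v\<close> remains.\<close>
    if "a * (mom3 h p v + 3 * g * mom2 h p v
      + g ^ 4 / 4 + (p + h) * g ^ 3 + 3 * (v + p * h + h ^ 2 / 2) * g ^ 2)
      + b * mom3 h p v + c * mom2 h p v = 1 / 4" for a b c
  proof -
    have "w * (a * (t + g) ^ 3 + b * t ^ 3 + c * t ^ 2) =
      a * (w * t ^ 3 + 3 * g * (w * t ^ 2) + 3 * g ^ 2 * (w * t) + g ^ 3 * w)
      + b * (w * t ^ 3) + c * (w * t ^ 2)"
      by (simp add: algebra_simps power2_eq_square power3_eq_cube)
    thus ?thesis unfolding that[symmetric] assms(3,4) unfolding mom3_def[of g]
      by (simp add: algebra_simps)
  qed
  moreover have "1 / (g ^ 2 * (g + h) ^ 2) * (mom3 h p v + 3 * g * mom2 h p v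
      + g ^ 4 / 4 + (p + h) * g ^ 3 + 3 * (v + p * h + h ^ 2 / 2) * g ^ 2)
      + (2 * g - h) / (h ^ 3 * g ^ 2) * mom3 h p v + - 3 / (h ^ 2 * g) * mom2 h p v = 1 / 4"
  proof -
    have "g + h \<noteq> 0" "h \<noteq> 0" "g \<noteq> 0" using assms by auto
    \<comment> \<open>The left side is \<open>mom3 (g + h) p v\<close>, the moment of the two cells
      joined into one.\<close>
    have "mom3 h p v + 3 * g * mom2 h p v
      + g ^ 4 / 4 + (p + h) * g ^ 3 + 3 * (v + p * h + h ^ 2 / 2) * g ^ 2 =
      (g + h) ^ 2 * ((g + h) ^ 2 / 4 + p * (g + h) + 3 * v)"
      by (simp add: mom2_def mom3_def field_simps power_def)
    hence "1 / (g ^ 2 * (g + h) ^ 2) * (mom3 h p v + 3 * g * mom2 h p v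
      + g ^ 4 / 4 + (p + h) * g ^ 3 + 3 * (v + p * h + h ^ 2 / 2) * g ^ 2) =
      ((g + h) ^ 2 / 4 + p * (g + h) + 3 * v) / g ^ 2"
      using \<open>g + h \<noteq> 0\<close> by simp
    moreover have "((g + h) ^ 2 / 4 + p * (g + h) + 3 * v) / g ^ 2
      + (2 * g - h) / (h ^ 3 * g ^ 2) * mom3 h p v + - 3 / (h ^ 2 * g) * mom2 h p v = 1 / 4"
      using \<open>h \<noteq> 0\<close> \<open>g \<noteq> 0\<close> by (simp add: mom2_def mom3_def field_simps power_def)
    ultimately show ?thesis by simp
  qed
  ultimately show ?thesis .
qed

lemma coef_B_algebra:
  fixes h g p v w t :: real
  assumes "h > 0" "g > 0" "w * t ^ 2 = mom2 h p v" "w * t ^ 3 = mom3 h p v"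
  shows "1 / 4 - w * ((- 3 * g - 2 * h) / ((g + h) ^ 2 * g ^ 3) * (t + g) ^ 3
           + 3 / ((g + h) * g ^ 2) * (t + g) ^ 2
           + (2 * h - g) / (h ^ 2 * g ^ 3) * t ^ 3 + 3 / (h * g ^ 2) * t ^ 2)
         = (- 3 * g - 2 * h) / ((g + h) ^ 2 * g ^ 3) *
             mom3 g (p + h - w) (v + p * h + h ^ 2 / 2 - w * t)
           + 3 / ((g + h) * g ^ 2) * mom2 g (p + h - w) (v + p * h + h ^ 2 / 2 - w * t)"
proof -
  have "1 / 4 - w * (a * (t + g) ^ 3 + d * (t + g) ^ 2 + b * t ^ 3 + c * t ^ 2) =
      a * mom3 g (p + h - w) (v + p * h + h ^ 2 / 2 - w * t)
      + d * mom2 g (p + h - w) (v + p * h + h ^ 2 / 2 - w * t)"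
    if "a * (mom3 h p v + 3 * g * mom2 h p v
      + g ^ 4 / 4 + (p + h) * g ^ 3 + 3 * (v + p * h + h ^ 2 / 2) * g ^ 2)
      + d * (mom2 h p v + g ^ 3 / 3 + (p + h) * g ^ 2 + 2 * (v + p * h + h ^ 2 / 2) * g)
      + b * mom3 h p v + c * mom2 h p v = 1 / 4" for a b c d
  proof -
    have "w * (a * (t + g) ^ 3 + d * (t + g) ^ 2 + b * t ^ 3 + c * t ^ 2) =
      a * (w * t ^ 3 + 3 * g * (w * t ^ 2) + 3 * g ^ 2 * (w * t) + g ^ 3 * w)
      + d * (w * t ^ 2 + 2 * g * (w * t) + g ^ 2 * w)
      + b * (w * t ^ 3) + c * (w * t ^ 2)"
      by (simp add: algebra_simps power2_eq_square power3_eq_cube)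
    thus ?thesis unfolding that[symmetric] assms(3,4) unfolding mom3_def[of g] mom2_def[of g]
      by (simp add: algebra_simps)
  qed
  moreover have "(- 3 * g - 2 * h) / ((g + h) ^ 2 * g ^ 3) * (mom3 h p v + 3 * g * mom2 h p v
      + g ^ 4 / 4 + (p + h) * g ^ 3 + 3 * (v + p * h + h ^ 2 / 2) * g ^ 2)
      + 3 / ((g + h) * g ^ 2) * (mom2 h p v + g ^ 3 / 3 + (p + h) * g ^ 2
        + 2 * (v + p * h + h ^ 2 / 2) * g)
      + (2 * h - g) / (h ^ 2 * g ^ 3) * mom3 h p v + 3 / (h * g ^ 2) * mom2 h p v = 1 / 4"
  proof -
    have nz: "g + h \<noteq> 0" "h \<noteq> 0" "g \<noteq> 0" using assms by auto
    have 1: "mom3 h p v + 3 * g * mom2 h p v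
      + g ^ 4 / 4 + (p + h) * g ^ 3 + 3 * (v + p * h + h ^ 2 / 2) * g ^ 2 =
      (g + h) ^ 2 * ((g + h) ^ 2 / 4 + p * (g + h) + 3 * v)"
      by (simp add: mom2_def mom3_def field_simps power_def)
    have 2: "mom2 h p v + g ^ 3 / 3 + (p + h) * g ^ 2 + 2 * (v + p * h + h ^ 2 / 2) * g =
      (g + h) * ((g + h) ^ 2 / 3 + p * (g + h) + 2 * v)"
      by (simp add: mom2_def field_simps power_def)
    have "(- 3 * g - 2 * h) / ((g + h) ^ 2 * g ^ 3) *
      ((g + h) ^ 2 * ((g + h) ^ 2 / 4 + p * (g + h) + 3 * v)) =
      (- 3 * g - 2 * h) * ((g + h) ^ 2 / 4 + p * (g + h) + 3 * v) / g ^ 3"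
      "3 / ((g + h) * g ^ 2) * ((g + h) * ((g + h) ^ 2 / 3 + p * (g + h) + 2 * v)) =
      3 * ((g + h) ^ 2 / 3 + p * (g + h) + 2 * v) / g ^ 2"
      using nz by simp_all
    moreover have "(- 3 * g - 2 * h) * ((g + h) ^ 2 / 4 + p * (g + h) + 3 * v) / g ^ 3
      + 3 * ((g + h) ^ 2 / 3 + p * (g + h) + 2 * v) / g ^ 2
      + (2 * h - g) / (h ^ 2 * g ^ 3) * mom3 h p v + 3 / (h * g ^ 2) * mom2 h p v = 1 / 4"
      using nz by (simp add: mom2_def mom3_def field_simps power_def)
    ultimately show ?thesis unfolding 1 2 by simp
  qed
  ultimately show ?thesis .
qed

text \<open>The states at the two ends mirror each other, so the first and third moments about the
  centre vanish while the second is positive. For two distinct nodes this forces equal weights at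
  opposite points.\<close>

lemma symmetric_two_nodes:
  fixes h p v w1 w2 y1 y2 :: real
  assumes "h > 0" "p \<ge> 0" "v \<ge> 0" "y1 \<noteq> y2"
    and m0: "w1 + w2 = 2 * p + h" and m1: "w1 * y1 + w2 * y2 = p * h + h ^ 2 / 2"
    and m2: "w1 * y1 ^ 2 + w2 * y2 ^ 2 = mom2 h p v"
    and m3: "w1 * y1 ^ 3 + w2 * y2 ^ 3 = mom3 h p v"
  shows "y1 + y2 = h" "w1 = w2" "w1 > 0"
proof -
  define s1 s2 where "s1 = y1 - h / 2" and "s2 = y2 - h / 2"
  define Q where "Q = w1 * s1 ^ 2 + w2 * s2 ^ 2"
  have "Q = (w1 * y1 ^ 2 + w2 * y2 ^ 2) - h * (w1 * y1 + w2 * y2) + h ^ 2 / 4 * (w1 + w2)"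
    by (simp add: Q_def s1_def s2_def field_simps power2_eq_square)
  also have "\<dots> = h ^ 3 / 12 + p * h ^ 2 / 2 + 2 * v * h"
    unfolding m0 m1 m2 mom2_def by (simp add: field_simps power_def)
  also have "\<dots> > 0" using assms(1-3) by (auto intro!: add_pos_nonneg)
  finally have Q: "Q > 0" .
  have "w1 * s1 + w2 * s2 = (w1 * y1 + w2 * y2) - h / 2 * (w1 + w2)"
    by (simp add: s1_def s2_def field_simps)
  also have "\<dots> = 0" unfolding m0 m1 by (simp add: field_simps power_def)
  finally have 1: "w1 * s1 + w2 * s2 = 0" .
  have "w1 * s1 ^ 3 + w2 * s2 ^ 3 = (w1 * y1 ^ 3 + w2 * y2 ^ 3)
      - 3 / 2 * h * (w1 * y1 ^ 2 + w2 * y2 ^ 2)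
      + 3 / 4 * h ^ 2 * (w1 * y1 + w2 * y2) - h ^ 3 / 8 * (w1 + w2)"
    by (simp add: s1_def s2_def field_simps power_def)
  also have "\<dots> = 0" unfolding m0 m1 m2 m3 mom2_def mom3_def by (simp add: field_simps power_def)
  finally have 3: "w1 * s1 ^ 3 + w2 * s2 ^ 3 = 0" .
  have "(w1 * s1) * (s1 ^ 2 - s2 ^ 2) = (w1 * s1 ^ 3 + w2 * s2 ^ 3) - s2 ^ 2 * (w1 * s1 + w2 * s2)"
    "(w2 * s2) * (s2 ^ 2 - s1 ^ 2) = (w1 * s1 ^ 3 + w2 * s2 ^ 3) - s1 ^ 2 * (w1 * s1 + w2 * s2)"
    by (simp_all add: algebra_simps power_def)
  hence z: "(w1 * s1) * (s1 ^ 2 - s2 ^ 2) = 0" "(w2 * s2) * (s2 ^ 2 - s1 ^ 2) = 0"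
    unfolding 1 3 by simp_all
  have "s1 ^ 2 = s2 ^ 2"
  proof (rule ccontr)
    assume "s1 ^ 2 \<noteq> s2 ^ 2"
    hence "w1 * s1 = 0" "w2 * s2 = 0" using z by auto
    hence "Q = 0" by (auto simp: Q_def)
    thus False using Q by simp
  qed
  moreover have "s1 \<noteq> s2" using assms(4) by (simp add: s1_def s2_def)
  ultimately have s: "s1 = - s2" by (auto simp: power2_eq_iff)
  thus "y1 + y2 = h" by (simp add: s1_def s2_def)
  have "s2 \<noteq> 0" using s \<open>s1 \<noteq> s2\<close> by auto
  moreover have "(w2 - w1) * s2 = 0" using 1 s by (simp add: algebra_simps)
  ultimately show w: "w1 = w2" by simp
  have "Q = 2 * w1 * s2 ^ 2" unfolding Q_def w s by simp
  thus "w1 > 0" using Q by (simp add: zero_less_mult_iff)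
qed

lemma sum_max_power_restrict:
  fixes \<omega> f :: "nat \<Rightarrow> real"
  assumes "finite I" "k > 0"
  shows "(\<Sum>i\<in>I. \<omega> i * max 0 (f i) ^ k) = (\<Sum>i | i \<in> I \<and> 0 < f i. \<omega> i * f i ^ k)"
proof -
  have "(\<Sum>i | i \<in> I \<and> 0 < f i. \<omega> i * f i ^ k) = (\<Sum>i | i \<in> I \<and> 0 < f i. \<omega> i * max 0 (f i) ^ k)"
    by (rule sum.cong) auto
  also have "\<dots> = (\<Sum>i\<in>I. \<omega> i * max 0 (f i) ^ k)"
    using assms by (intro sum.mono_neutral_left) auto
  finally show ?thesis by simp
qed

text \<open>Here \<open>t\<close> is the distance to the right end of a cell of length
  \<open>h\<close> whose two neighbours have length \<open>g\<close>. The same B-spline piece is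
  written once from the right and once from the left.\<close>

lemma outer_bspline_reflect:
  fixes h g t :: real
  assumes "h > 0" "g > 0"
  shows "(2 * h - g) / (h ^ 2 * g ^ 3) * t ^ 3 + 3 / (h * g ^ 2) * t ^ 2
      + (- 3 * g - 2 * h) / ((g + h) ^ 2 * g ^ 3) * (t + g) ^ 3
      + 3 / ((g + h) * g ^ 2) * (t + g) ^ 2 = 1 / (h ^ 2 * (h + g) ^ 2) * (h - t) ^ 3"
proof -
  define s where "s = g + h"
  have "h \<noteq> 0" "g \<noteq> 0" "s \<noteq> 0" using assms by (auto simp: s_def)
  hence "(2 * h - g) / (h ^ 2 * g ^ 3) * t ^ 3 + 3 / (h * g ^ 2) * t ^ 2
      + (- 3 * g - 2 * h) / (s ^ 2 * g ^ 3) * (t + g) ^ 3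
      + 3 / (s * g ^ 2) * (t + g) ^ 2 = 1 / (h ^ 2 * s ^ 2) * (h - t) ^ 3"
    by (simp add: divide_simps) (simp add: s_def algebra_simps power_def)
  thus ?thesis by (simp add: s_def add.commute)
qed

lemma inner_bspline_reflect:
  fixes h g t :: real
  assumes "h > 0" "g > 0"
  shows "1 / (g ^ 2 * (g + h) ^ 2) * (t + g) ^ 3 + (2 * g - h) / (h ^ 3 * g ^ 2) * t ^ 3
      + - 3 / (h ^ 2 * g) * t ^ 2 =
     (- 3 * h - 2 * g) / ((h + g) ^ 2 * h ^ 3) * (h - t) ^ 3
      + 3 / ((h + g) * h ^ 2) * (h - t) ^ 2"
proof -
  define s where "s = g + h"
  have "h \<noteq> 0" "g \<noteq> 0" "s \<noteq> 0" using assms by (auto simp: s_def)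
  hence "1 / (g ^ 2 * s ^ 2) * (t + g) ^ 3 + (2 * g - h) / (h ^ 3 * g ^ 2) * t ^ 3
      + - 3 / (h ^ 2 * g) * t ^ 2 =
     (- 3 * h - 2 * g) / (s ^ 2 * h ^ 3) * (h - t) ^ 3 + 3 / (s * h ^ 2) * (h - t) ^ 2"
    by (simp add: divide_simps) (simp add: s_def algebra_simps power_def)
  thus ?thesis by (simp add: s_def add.commute)
qed

section \<open>Gluing the two halves\<close>

locale symmetric_rule =
  fixes n :: nat and a b :: real and x \<tau> \<omega> :: "nat \<Rightarrow> real"
  assumes n: "n \<ge> 2" and knots: "symmetrically_stretched_knots a b n x"
    and rule: "gaussian_rule n x \<tau> \<omega>"
begin

text \<open>An opaque constant, because the simplifier rewrites \<open>{1..n + 1}\<close>.\<close>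

definition "nodes = {1..n + 1}"

lemma finite_nodes [simp]: "finite nodes" and card_nodes: "card nodes = n + 1"
  by (simp_all add: nodes_def)

lemma knot_less: "k < n \<Longrightarrow> x k < x (Suc k)"
  and ends: "x 0 = a" "x n = b"
  and knot_sym: "k \<le> n \<Longrightarrow> x k + x (n - k) = a + b"
  and knot_stretched: "k < n div 2 \<Longrightarrow> x k - 2 * x (k + 1) + x (k + 2) \<ge> 0"
  using knots by (auto simp: symmetrically_stretched_knots_def)

lemma knot_mono: "i \<le> j \<Longrightarrow> j \<le> n \<Longrightarrow> x i \<le> x j"
proof (induction j rule: dec_induct)
  case (step k)
  thus ?case using knot_less[of k] by simp
qed simp

lemma node_bounds: "i \<in> nodes \<Longrightarrow> a \<le> \<tau> i \<and> \<tau> i \<le> b"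
  and exact: "f \<in> cubic_splines_C1 n x \<Longrightarrow> (\<Sum>i\<in>nodes. \<omega> i * f (\<tau> i)) = integral {a..b} f"
  and node_less_Suc: "i \<in> {1..n} \<Longrightarrow> \<tau> i < \<tau> (i + 1)"
  using rule by (auto simp: gaussian_rule_def ends nodes_def)

lemma node_less: "1 \<le> i \<Longrightarrow> i < k \<Longrightarrow> k \<le> n + 1 \<Longrightarrow> \<tau> i < \<tau> k"
proof -
  have "i \<le> j \<Longrightarrow> 1 \<le> i \<Longrightarrow> j \<le> n \<Longrightarrow> \<tau> i < \<tau> (Suc j)" for i j
  proof (induction j rule: dec_induct)
    case base
    thus ?case using node_less_Suc[of i] by simp
  next
    case (step k)
    thus ?case using node_less_Suc[of "Suc k"] by simp
  qed
  from this[of i "k - 1"] show "1 \<le> i \<Longrightarrow> i < k \<Longrightarrow> k \<le> n + 1 \<Longrightarrow> \<tau> i < \<tau> k" by simp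
qed

lemma inj_nodes: "inj_on \<tau> nodes"
  unfolding nodes_def
  by (rule linorder_inj_onI) (use node_less in force)+

text \<open>The value \<open>s = -1\<close> gives the powers \<open>(x j - t)\<^sub>+\<close> for
  the left half, and \<open>s = 1\<close> gives \<open>(t - x j)\<^sub>+\<close> for the reflected
  half.\<close>

lemma exact_truncated:
  assumes j: "j \<le> n" and k: "k > 0" "k \<le> 2" and s: "s = 1 \<or> s = -1"
  shows "(\<Sum>i | i \<in> nodes \<and> 0 < s * (\<tau> i - x j). \<omega> i * (s * (\<tau> i - x j)) ^ Suc k) =
     s * (max 0 (s * (b - x j)) ^ Suc (Suc k) - max 0 (s * (a - x j)) ^ Suc (Suc k)) / real (Suc (Suc k))"
proof -
  have "(\<lambda>t. max 0 (s * (t - x j)) ^ Suc k) \<in> cubic_splines_C1 n x"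
  proof (rule truncated_power_spline[OF k])
    fix i assume i: "i < n"
    show "(\<forall>t\<in>{x i<..<x (i + 1)}. s * (t - x j) \<le> 0) \<or>
         (\<forall>t\<in>{x i<..<x (i + 1)}. 0 \<le> s * (t - x j))"
    proof (cases "i < j")
      case True
      hence "x (i + 1) \<le> x j" using knot_mono[of "i + 1" j] j by simp
      thus ?thesis using s by auto
    next
      case False
      hence "x j \<le> x i" using knot_mono[of j i] i by simp
      thus ?thesis using s by auto
    qed
  qed
  note e = exact[OF this]
  have ab: "a \<le> b" using knot_mono[of 0 n] ends by simp
  have "s ^ 2 = 1" using s by auto
  note e = e[unfolded truncated_power_integral[OF zero_less_Suc ab this]]
  show ?thesis using sum_max_power_restrict[of "nodes" "Suc k" \<omega> "\<lambda>i. s * (\<tau> i - x j)"] e by simp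
qed

lemma exact_0: "(\<Sum>i\<in>nodes. \<omega> i) = b - a"
  and exact_1: "(\<Sum>i\<in>nodes. \<omega> i * \<tau> i) = (b ^ 2 - a ^ 2) / 2"
proof -
  have ab: "a \<le> b" using knot_mono[of 0 n] ends by simp
  have polys: "poly [:1:] = (\<lambda>t. 1 :: real)" "poly [:0, 1:] = (\<lambda>t. t :: real)"
    by (auto simp: fun_eq_iff)
  show "(\<Sum>i\<in>nodes. \<omega> i) = b - a"
    using exact[OF poly_spline[of "[:1:]"]] ab unfolding polys by simp
  have "((\<lambda>t. t ^ 2 / 2) has_vector_derivative t) (at t within {a..b})" for t :: real
    by (auto intro!: derivative_eq_intros simp flip: has_real_derivative_iff_has_vector_derivative)
  from fundamental_theorem_of_calculus[OF ab this]
  have "integral {a..b} (\<lambda>t. t) = (b ^ 2 - a ^ 2) / 2" 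
    by (intro integral_unique) (simp add: diff_divide_distrib)
  thus "(\<Sum>i\<in>nodes. \<omega> i * \<tau> i) = (b ^ 2 - a ^ 2) / 2"
    using exact[OF poly_spline[of "[:0, 1:]"]] unfolding polys by simp
qed

lemma exact_below:
  assumes "j \<le> n" "k > 0" "k \<le> 2"
  shows "(\<Sum>i | i \<in> nodes \<and> \<tau> i < x j. \<omega> i * (x j - \<tau> i) ^ Suc k) =
     (x j - a) ^ Suc (Suc k) / real (Suc (Suc k))"
proof -
  have "max 0 (x j - b) = 0" "max 0 (x j - a) = x j - a"
    using knot_mono[of 0 j] knot_mono[of j n] assms(1) ends by auto
  thus ?thesis using exact_truncated[OF assms, of "-1"] by simp
qed

lemma exact_above:
  assumes "j \<le> n" "k > 0" "k \<le> 2"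
  shows "(\<Sum>i | i \<in> nodes \<and> x j < \<tau> i. \<omega> i * (\<tau> i - x j) ^ Suc k) =
     (b - x j) ^ Suc (Suc k) / real (Suc (Suc k))"
proof -
  have "max 0 (a - x j) = 0" "max 0 (b - x j) = b - x j"
    using knot_mono[of 0 j] knot_mono[of j n] assms(1) ends by auto
  thus ?thesis using exact_truncated[OF assms, of 1] by simp
qed

text \<open>Rounded up: for odd \<open>n\<close> the middle cell belongs to the left half and to the
  reflected one.\<close>

abbreviation "M \<equiv> (n + 1) div 2"

sublocale L: half_rule x M "nodes" \<tau> \<omega>
proof
  show "x j < x (Suc j)" if "j < M" for j using that n by (intro knot_less) linarith
  show "x (Suc j) - x j \<le> x (Suc (Suc j)) - x (Suc j)" if "Suc j < M" for j
  proof -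
    have "j < n div 2" using that by linarith
    thus ?thesis using knot_stretched[of j] by simp
  qed
  show "inj_on \<tau> nodes" by (rule inj_nodes)
  show "x 0 \<le> \<tau> i" if "i \<in> nodes" for i using node_bounds[OF that] ends by simp
  show "(\<Sum>i | i \<in> nodes \<and> \<tau> i < x j. \<omega> i * (x j - \<tau> i) ^ 2) = (x j - x 0) ^ 3 / 3"
    "(\<Sum>i | i \<in> nodes \<and> \<tau> i < x j. \<omega> i * (x j - \<tau> i) ^ 3) = (x j - x 0) ^ 4 / 4"
    if "j \<le> M" for j
  proof -
    have "j \<le> n" using that n by linarith
    thus "(\<Sum>i | i \<in> nodes \<and> \<tau> i < x j. \<omega> i * (x j - \<tau> i) ^ 2) = (x j - x 0) ^ 3 / 3"
      "(\<Sum>i | i \<in> nodes \<and> \<tau> i < x j. \<omega> i * (x j - \<tau> i) ^ 3) = (x j - x 0) ^ 4 / 4"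
      using exact_below[of j 1] exact_below[of j 2]
      by (simp_all add: ends eval_nat_numeral)
  qed
qed simp

text \<open>The knots are symmetric, so the reflected rule lives on the same knots, and exactness
  for right truncated powers becomes exactness for left ones.\<close>

sublocale R: half_rule x M "nodes" "\<lambda>i. a + b - \<tau> i" \<omega>
proof
  show "inj_on (\<lambda>i. a + b - \<tau> i) nodes" using inj_nodes by (auto simp: inj_on_def)
  show "x 0 \<le> a + b - \<tau> i" if "i \<in> nodes" for i using node_bounds[OF that] ends by simp
  show "(\<Sum>i | i \<in> nodes \<and> a + b - \<tau> i < x j. \<omega> i * (x j - (a + b - \<tau> i)) ^ 2) = (x j - x 0) ^ 3 / 3"
    "(\<Sum>i | i \<in> nodes \<and> a + b - \<tau> i < x j. \<omega> i * (x j - (a + b - \<tau> i)) ^ 3) = (x j - x 0) ^ 4 / 4"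
    if "j \<le> M" for j
  proof -
    have "j \<le> n" using that n by linarith
    hence xj: "x j = a + b - x (n - j)" using knot_sym[of j] by simp
    show "(\<Sum>i | i \<in> nodes \<and> a + b - \<tau> i < x j. \<omega> i * (x j - (a + b - \<tau> i)) ^ 2) = (x j - x 0) ^ 3 / 3"
    "(\<Sum>i | i \<in> nodes \<and> a + b - \<tau> i < x j. \<omega> i * (x j - (a + b - \<tau> i)) ^ 3) = (x j - x 0) ^ 4 / 4"
      unfolding xj using exact_above[of "n - j" 1] exact_above[of "n - j" 2] 
      by (simp_all add: ends eval_nat_numeral)
  qed
qed simp

lemma R_below: "k \<le> n \<Longrightarrow> R.below k = {i \<in> nodes. x (n - k) < \<tau> i}"
  using knot_sym[of k] by (auto simp: R.below_def)

section \<open>Matching the two halves at a knot\<close>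

definition "on_knot j = {i \<in> nodes. \<tau> i = x j}"

lemma finite_on_knot [simp]: "finite (on_knot j)" by (simp add: on_knot_def)

lemma card_on_knot: "card (on_knot j) \<le> 1"
  using inj_nodes by (auto simp: card_le_Suc0_iff_eq on_knot_def inj_on_def)

context
  fixes j k assumes jk: "j + k = n"
begin

lemma sum_split: "sum f nodes = sum f (L.below j) + sum f (R.below k) + (sum f (on_knot j) :: 'a :: comm_monoid_add)"
proof -
  have "k \<le> n" "n - k = j" using jk by auto
  note R = R_below[OF this(1), unfolded this(2)]
  have "nodes = (L.below j \<union> R.below k) \<union> on_knot j"
    by (auto simp: R L.below_def on_knot_def)
  moreover have "sum f ((L.below j \<union> R.below k) \<union> on_knot j) = 
     sum f (L.below j \<union> R.below k) + sum f (on_knot j)"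
    by (rule sum.union_disjoint) (auto simp: R L.below_def on_knot_def)
  moreover have "sum f (L.below j \<union> R.below k) = sum f (L.below j) + sum f (R.below k)"
    by (rule sum.union_disjoint) (auto simp: R L.below_def on_knot_def)
  ultimately show ?thesis by simp
qed

lemma card_split: "card (L.below j) + card (R.below k) + card (on_knot j) = n + 1"
  using sum_split[of "\<lambda>_. 1 :: nat"] card_nodes by simp

lemma mirror_knot: "x k = a + b - x j"
proof -
  have "j \<le> n" "n - j = k" using jk by auto
  thus ?thesis using knot_sym[of j] by simp
qed

text \<open>Exactness for constants: a node on the knot belongs to neither half and must balance the
  two errors.\<close>

lemma P_glue: "L.P j + R.P k = (\<Sum>i\<in>on_knot j. \<omega> i)"
proof -
  show ?thesis using mirror_knot sum_split[of \<omega>] exact_0 by (simp add: L.P_def R.P_def ends)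
qed

text \<open>Exactness for constants and for the identity; a node on the knot contributes nothing, as
  \<open>x j - \<tau> i\<close> vanishes there.\<close>

lemma V_glue: "L.V j = R.V k"
proof -
  note xk = mirror_knot
  have 1: "(\<Sum>i\<in>R.below k. \<omega> i * (x k - (a + b - \<tau> i))) = - (\<Sum>i\<in>R.below k. \<omega> i * (x j - \<tau> i))"
    by (simp add: xk algebra_simps flip: sum_negf)
  have 2: "(\<Sum>i\<in>on_knot j. \<omega> i * (x j - \<tau> i)) = 0"
    by (rule sum.neutral) (auto simp: on_knot_def)
  have "(\<Sum>i\<in>nodes. \<omega> i * (x j - \<tau> i)) = x j * (\<Sum>i\<in>nodes. \<omega> i) - (\<Sum>i\<in>nodes. \<omega> i * \<tau> i)"
    by (simp add: sum_distrib_left algebra_simps flip: sum_subtractf)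
  hence 3: "(\<Sum>i\<in>nodes. \<omega> i * (x j - \<tau> i)) = x j * (b - a) - (b ^ 2 - a ^ 2) / 2"
    unfolding exact_0 exact_1 .
  have "(\<Sum>i\<in>nodes. \<omega> i * (x j - \<tau> i)) = (\<Sum>i\<in>L.below j. \<omega> i * (x j - \<tau> i)) 
     + (\<Sum>i\<in>R.below k. \<omega> i * (x j - \<tau> i))"
    unfolding sum_split 2 by simp
  with 3 have "(\<Sum>i\<in>L.below j. \<omega> i * (x j - \<tau> i)) =
     x j * (b - a) - (b ^ 2 - a ^ 2) / 2 - (\<Sum>i\<in>R.below k. \<omega> i * (x j - \<tau> i))" by linarith
  thus ?thesis unfolding L.V_def R.V_def 1 unfolding ends xk
    by (simp add: field_simps power2_eq_square)
qed

text \<open>Each half has at least as many nodes as cells, and at least one more unless it is ideal.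
  With \<open>n + 1\<close> nodes in all, one half is ideal, and the extra node lies on the knot or
  in the other half.\<close>

lemma middle_cases:
  assumes "j \<le> M" "k \<le> M" "0 < j" "0 < k"
  shows "(L.ideal_upto j \<and> R.ideal_upto k \<and> card (on_knot j) = 1 \<and> ideal_v x j = ideal_v x k) \<or>
    (L.ideal_upto j \<and> on_knot j = {} \<and> ideal_v x j < ideal_v x k) \<or>
    (R.ideal_upto k \<and> on_knot j = {} \<and> ideal_v x k < ideal_v x j)"
proof -
  note c = card_split card_on_knot[of j]
  have cL: "card (L.below j) = j" "L.P j = ideal_p x j" "L.V j = ideal_v x j" if "L.ideal_upto j"
    using that by (auto simp: L.ideal_upto_def)
  have cR: "card (R.below k) = k" "R.P k = ideal_p x k" "R.V k = ideal_v x k" if "R.ideal_upto k"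
    using that by (auto simp: R.ideal_upto_def)
  have cL': "j + 1 \<le> card (L.below j)" if "\<not> L.ideal_upto j"
    using L.states[OF assms(1)] that by (auto simp: L.surplus_one_def L.after_reset_def)
  have cR': "k + 1 \<le> card (R.below k)" if "\<not> R.ideal_upto k"
    using R.states[OF assms(2)] that by (auto simp: R.surplus_one_def R.after_reset_def)
  note pos = L.ideal_p_pos[OF assms(1,3)] L.ideal_p_pos[OF assms(2,4)]
    L.ideal_nonneg(2)[OF assms(1)] L.ideal_nonneg(2)[OF assms(2)]
  show ?thesis
  proof (cases "L.ideal_upto j")
    case a: True
    show ?thesis
    proof (cases "R.ideal_upto k")
      case b: True
      thus ?thesis using a cL(1,3) cR(1,3) c jk V_glue by auto
    next
      case b: False
      hence "card (R.below k) = k + 1" "card (on_knot j) = 0" using cL(1)[OF a] cR'[OF b] c jk by linarith+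
      hence z: "on_knot j = {}" and s: "R.surplus_one k \<or> R.after_reset k"
        using R.states[OF assms(2)] b by auto
      \<comment> \<open>Without a node on the knot, \<open>R.P k\<close> is negative; this excludes
        \<open>after_reset\<close> and meets the premise of \<open>surplus_one\<close>.\<close>
      have P: "R.P k = - ideal_p x j" "R.V k = ideal_v x j"
        using P_glue V_glue z cL[OF a] by auto
      hence "ideal_v x j < ideal_v x k"
        using s pos by (auto simp: R.surplus_one_def R.after_reset_def)
      thus ?thesis using a z by simp
    qed
  next
    case a: False
    have b: "R.ideal_upto k" using cR' cL'[OF a] c jk by fastforce
    hence "card (L.below j) = j + 1" "card (on_knot j) = 0" using cR(1)[OF b] cL'[OF a] c jk by linarith+
    hence z: "on_knot j = {}" and s: "L.surplus_one j \<or> L.after_reset j"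
      using L.states[OF assms(1)] a by auto
    have P: "L.P j = - ideal_p x k" "L.V j = ideal_v x k"
      using P_glue V_glue z cR[OF b] by auto
    hence "ideal_v x k < ideal_v x j"
      using s pos by (auto simp: L.surplus_one_def L.after_reset_def)
    thus ?thesis using b z by simp
  qed
qed

end

section \<open>Numbering of the nodes and the explicit formulas\<close>

lemma L_below_iff: "i \<in> L.below j \<longleftrightarrow> 1 \<le> i \<and> i \<le> n + 1 \<and> \<tau> i < x j"
  unfolding L.below_def by (simp add: nodes_def)

lemma below_initial: "L.below j = {1..card (L.below j)}"
proof (cases "L.below j = {}")
  case False
  define q where "q = Max (L.below j)"
  have q: "q \<in> L.below j" using False by (simp add: q_def)
  have "L.below j = {1..q}"
  proof
    show "L.below j \<subseteq> {1..q}" by (auto simp: q_def L_below_iff)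
    show "{1..q} \<subseteq> L.below j"
    proof
      fix i assume "i \<in> {1..q}"
      thus "i \<in> L.below j"
        using q node_less[of i q] by (cases "i = q") (auto simp: L_below_iff)
    qed
  qed
  thus ?thesis by simp
qed simp

lemma cell_ideal:
  assumes "L.ideal_upto (Suc j)" "j < M"
  shows "L.cell j = {Suc j}"
proof -
  have "L.cell j = L.below (Suc j) - L.below j"
    using L.below_Suc[OF assms(2)] by auto
  moreover have "L.below j = {1..j}" "L.below (Suc j) = {1..Suc j}"
    using below_initial[of j] below_initial[of "Suc j"] assms(1) by (auto simp: L.ideal_upto_def)
  ultimately show ?thesis by auto
qed

lemma ideal_upto_le: "L.ideal_upto k \<Longrightarrow> j \<le> k \<Longrightarrow> L.ideal_upto j"
  by (simp add: L.ideal_upto_def)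

lemma knot_nat: "k \<le> n \<Longrightarrow> knot n x (int k) = x k"
  by (simp add: knot_def)

lemma step_Suc: "Suc k \<le> n \<Longrightarrow> step n x (Suc k) = x (Suc k) - x k"
  using knot_nat[of k] knot_nat[of "Suc k"] by (simp add: step_def)

lemma theta: "k \<le> n \<Longrightarrow> node_theta n x \<tau> k = x k - \<tau> k"
  using knot_nat[of k] by (simp add: node_theta_def)

lemma rho: "Suc k \<le> n \<Longrightarrow> node_rho n x \<tau> k = node_theta n x \<tau> k + (x (Suc k) - x k)"
  using knot_nat[of k] knot_nat[of "Suc k"] by (simp add: node_theta_def node_rho_def add.commute)

lemma node_moments:
  assumes "L.ideal_upto (Suc j)" "j < M"
  shows "\<omega> (Suc j) > 0" "node_theta n x \<tau> (Suc j) > 0"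
    "\<omega> (Suc j) * node_theta n x \<tau> (Suc j) ^ 2 = mom2 (x (Suc j) - x j) (L.P j) (L.V j)"
    "\<omega> (Suc j) * node_theta n x \<tau> (Suc j) ^ 3 = mom3 (x (Suc j) - x j) (L.P j) (L.V j)"
    "L.P (Suc j) = L.P j + (x (Suc j) - x j) - \<omega> (Suc j)"
    "L.V (Suc j) = L.V j + L.P j * (x (Suc j) - x j) + (x (Suc j) - x j) ^ 2 / 2
       - \<omega> (Suc j) * node_theta n x \<tau> (Suc j)"
proof -
  have "Suc j \<le> n" using assms(2) n by linarith
  note t = theta[OF this]
  have "L.ideal_upto j" by (rule ideal_upto_le[OF assms(1)]) simp
  note s = L.ideal_upto_Suc[OF assms(2) this cell_ideal[OF assms]]
  show "\<omega> (Suc j) > 0"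
    "\<omega> (Suc j) * node_theta n x \<tau> (Suc j) ^ 2 = mom2 (x (Suc j) - x j) (L.P j) (L.V j)"
    "\<omega> (Suc j) * node_theta n x \<tau> (Suc j) ^ 3 = mom3 (x (Suc j) - x j) (L.P j) (L.V j)"
    "L.P (Suc j) = L.P j + (x (Suc j) - x j) - \<omega> (Suc j)"
    "L.V (Suc j) = L.V j + L.P j * (x (Suc j) - x j) + (x (Suc j) - x j) ^ 2 / 2
       - \<omega> (Suc j) * node_theta n x \<tau> (Suc j)"
    unfolding t using s(2-6) by simp_all
  have "Suc j \<in> L.cell j" using cell_ideal[OF assms] by simp
  thus "node_theta n x \<tau> (Suc j) > 0" unfolding t by (simp add: L.cell_def)
qed

text \<open>The next cell enters only through its moments, with no assumption on its nodes, so the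
  formulas remain available at the middle.\<close>

lemma coef_eqs:
  assumes "L.ideal_upto (Suc j)" "j < M" "Suc (Suc j) \<le> n"
  defines "g \<equiv> x (Suc (Suc j)) - x (Suc j)"
  shows "coef_A n x \<tau> \<omega> (Suc j) = coef_a n x (Suc (Suc j)) * mom3 g (L.P (Suc j)) (L.V (Suc j))"
    "coef_B n x \<tau> \<omega> (Suc j) = coef_alpha n x (Suc (Suc j)) * mom3 g (L.P (Suc j)) (L.V (Suc j))
       + coef_beta n x (Suc (Suc j)) * mom2 g (L.P (Suc j)) (L.V (Suc j))"
proof -
  have s: "step n x (Suc (Suc j)) = g" "step n x (Suc j) = x (Suc j) - x j"
    using step_Suc[of j] step_Suc[of "Suc j"] assms(3) by (auto simp: g_def)
  have pos: "x (Suc j) - x j > 0" "g > 0"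
    using knot_less[of j] knot_less[of "Suc j"] assms(3) by (auto simp: g_def)
  have r: "node_rho n x \<tau> (Suc j) = node_theta n x \<tau> (Suc j) + g"
    using rho[of "Suc j"] assms(3) by (simp add: g_def)
  note m = node_moments[OF assms(1,2)]
  show "coef_A n x \<tau> \<omega> (Suc j) = coef_a n x (Suc (Suc j)) * mom3 g (L.P (Suc j)) (L.V (Suc j))"
    using coef_A_algebra[OF pos m(3,4)]
    unfolding m(5,6) coef_A_def coef_a_def coef_b_def coef_c_def Let_def r by (simp add: s)
  show "coef_B n x \<tau> \<omega> (Suc j) = coef_alpha n x (Suc (Suc j)) * mom3 g (L.P (Suc j)) (L.V (Suc j))
       + coef_beta n x (Suc (Suc j)) * mom2 g (L.P (Suc j)) (L.V (Suc j))"
    using coef_B_algebra[OF pos m(3,4)]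
    unfolding m(5,6) coef_B_def coef_alpha_def coef_beta_def coef_gamma_def coef_eta_def Let_def r
    by (simp add: s)
qed

lemma coef_pos:
  assumes "j < n" "0 < j"
  shows "coef_a n x (Suc j) > 0" "coef_beta n x (Suc j) > 0"
proof -
  have "step n x (Suc j) > 0" "step n x j > 0"
    using step_Suc[of j] step_Suc[of "j - 1"] knot_less[of j] knot_less[of "j - 1"] assms by auto
  thus "coef_a n x (Suc j) > 0" "coef_beta n x (Suc j) > 0"
    by (auto simp: coef_a_def coef_beta_def Let_def)
qed

text \<open>For even \<open>n\<close> the strict alternatives compare a value with itself. For odd
  \<open>n\<close> the strict growth of \<open>ideal_v\<close> leaves only the alternative with an
  ideal left half.\<close>

lemma ideal_half: "L.ideal_upto (n div 2)"
proof (cases "even n")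
  case True
  then obtain m where m: "n = 2 * m" by blast
  thus ?thesis using middle_cases[of m m] n by auto
next
  case False
  then obtain m where "n = 2 * m + 1" by (rule oddE)
  hence m: "n = Suc (2 * m)" by simp
  have "ideal_v x m < ideal_v x (Suc m)" using L.ideal_v_less[of m] m by simp
  thus ?thesis using middle_cases[of m "Suc m"] m n by auto
qed

lemma first_node:
  shows "node_theta n x \<tau> 1 = 3 / 4 * step n x 1" "\<omega> 1 = 16 / 27 * step n x 1"
proof -
  have I: "L.ideal_upto (Suc 0)" by (rule ideal_upto_le[OF ideal_half]) (use n in auto)
  have "0 < M" using n by auto
  define h where "h = x 1 - x 0"
  have h: "h > 0" using knot_less[of 0] n by (simp add: h_def)
  have m: "\<omega> 1 * node_theta n x \<tau> 1 ^ 2 = h ^ 3 / 3" "\<omega> 1 * node_theta n x \<tau> 1 ^ 3 = h ^ 4 / 4"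
    using node_moments(3,4)[OF I \<open>0 < M\<close>] by (auto simp: mom2_def mom3_def h_def)
  have "h ^ 3 / 3 > 0" "h ^ 4 / 4 > 0" using h by auto
  note s = mom_solve(3,4)[OF m this]
  have "step n x 1 = h" using step_Suc[of 0] n by (simp add: h_def)
  thus "node_theta n x \<tau> 1 = 3 / 4 * step n x 1" "\<omega> 1 = 16 / 27 * step n x 1"
    using s h by (simp_all add: power_def)
qed

lemma recurrence:
  assumes i: "i \<in> {1..n div 2 - 1}"
  defines "A \<equiv> coef_A n x \<tau> \<omega> i" and "B \<equiv> coef_B n x \<tau> \<omega> i"
    and "\<theta> \<equiv> node_theta n x \<tau> (i + 1)"
    and "aa \<equiv> coef_a n x (i + 1)" and "\<alpha> \<equiv> coef_alpha n x (i + 1)" and "\<beta> \<equiv> coef_beta n x (i + 1)"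
  shows "aa * B - \<alpha> * A \<noteq> 0" "\<theta> = A * \<beta> / (aa * B - \<alpha> * A)"
    "aa * \<theta> ^ 3 \<noteq> 0" "\<omega> (i + 1) = A / (aa * \<theta> ^ 3)"
proof -
  obtain j where j: "i = Suc j" using i by (cases i) auto
  have le: "Suc i \<le> n div 2" "j < M" "i < M" "Suc (Suc j) \<le> n" "i < n" "0 < i" using i j by auto
  have I: "L.ideal_upto (Suc j)" "L.ideal_upto (Suc i)"
    by (rule ideal_upto_le[OF ideal_half]; use le j in simp)+
  note m = node_moments[OF I(2) le(3)]
  note c = coef_eqs[OF I(1) le(2,4)]
  have A: "A = aa * (\<omega> (i + 1) * \<theta> ^ 3)" and B: "B = \<alpha> * (\<omega> (i + 1) * \<theta> ^ 3) + \<beta> * (\<omega> (i + 1) * \<theta> ^ 2)"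
    using c m(3,4) by (simp_all add: A_def B_def \<theta>_def aa_def \<alpha>_def \<beta>_def j)
  have pos: "aa > 0" "\<beta> > 0" "\<theta> > 0" "\<omega> (i + 1) > 0"
    using coef_pos[OF le(5,6)] m(1,2) by (auto simp: aa_def \<beta>_def \<theta>_def)
  \<comment> \<open>The third moments cancel and the second remains, so that the quotient below is
    \<open>\<theta>\<close>.\<close>
  have d: "aa * B - \<alpha> * A = aa * \<beta> * \<omega> (i + 1) * \<theta> ^ 2"
    unfolding A B by (simp add: algebra_simps)
  show "aa * B - \<alpha> * A \<noteq> 0" unfolding d using pos by simp
  show "\<theta> = A * \<beta> / (aa * B - \<alpha> * A)" unfolding d unfolding A using pos by (simp add: power_def)
  show "aa * \<theta> ^ 3 \<noteq> 0" using pos by simp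
  show "\<omega> (i + 1) = A / (aa * \<theta> ^ 3)" unfolding A using pos by simp
qed

text \<open>Both halves are ideal, and the remaining node sits on the middle knot; its weight is the
  sum of two equal values of \<open>P\<close>.\<close>

lemma even_middle:
  assumes m: "n = 2 * m"
  shows "\<tau> (m + 1) = x m" "x m = (a + b) / 2"
    "coef_a n x (m + 1) * node_theta n x \<tau> (m + 1) ^ 3 \<noteq> 0"
    "\<omega> (m + 1) = (coef_A n x \<tau> \<omega> m + coef_B n x \<tau> \<omega> m - 1 / 4)
       / (coef_a n x (m + 1) * node_theta n x \<tau> (m + 1) ^ 3)"
proof -
  have I: "L.ideal_upto m" "R.ideal_upto m" "card (on_knot m) = 1"
    using middle_cases[of m m] m n by auto
  then obtain i where i: "on_knot m = {i}" by (auto simp: card_1_singleton_iff)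
  have "i \<in> on_knot m" using i by simp
  hence i': "\<tau> i = x m" "1 \<le> i" "i \<le> n + 1" by (auto simp: on_knot_def nodes_def)
  have below: "L.below m = {1..m}"
    using below_initial[of m] I by (auto simp: L.ideal_upto_def)
  have "i \<notin> L.below m" using i' by (simp add: L.below_def)
  hence "m + 1 \<le> i" using below i' by auto
  hence "\<tau> (m + 1) \<le> x m" using node_less[of "m + 1" i] i' by (cases "m + 1 = i") auto
  moreover have "m + 1 \<notin> L.below m" using below by simp
  hence "x m \<le> \<tau> (m + 1)" using m unfolding L_below_iff by auto
  ultimately show t: "\<tau> (m + 1) = x m" by simp
  hence "m + 1 \<in> on_knot m" unfolding on_knot_def nodes_def using m by simp
  hence z: "on_knot m = {m + 1}" using i by auto
  show "x m = (a + b) / 2" using knot_sym[of m] m by simp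
  obtain j where j: "m = Suc j" using n m by (cases m) auto
  define h where "h = x m - x j"
  have lt: "m < n" "0 < m" "j < M" "Suc (Suc j) \<le> n" "m + 1 \<le> n" using j m by auto
  have h: "h > 0" using knot_less[of j] lt by (simp add: h_def j)
  have g: "x (m + 1) - x m = h"
    using knot_sym[of m] knot_sym[of j] m j by (simp add: h_def algebra_simps)
  have s: "step n x (m + 1) = h" "step n x m = h"
    using step_Suc[of m] step_Suc[of j] lt g by (auto simp: h_def j)
  have th: "node_theta n x \<tau> (m + 1) = h" using theta[OF lt(5)] t g by simp
  define p v where "p = L.P m" and "v = L.V m"
  have "R.P m = p" using I by (simp add: p_def L.ideal_upto_def R.ideal_upto_def)
  hence w: "\<omega> (m + 1) = 2 * p" using P_glue[of m m] m z by (simp add: p_def)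
  have a: "coef_a n x (m + 1) = 1 / (4 * h ^ 4)" "coef_alpha n x (m + 1) = - 5 / (4 * h ^ 4)"
    "coef_beta n x (m + 1) = 3 / (2 * h ^ 3)"
    using s h by (simp_all add: coef_a_def coef_alpha_def coef_beta_def Let_def power_def)
  have "L.ideal_upto (Suc j)" using I j by simp
  note c = coef_eqs[OF this lt(3,4)]
  have AB: "coef_A n x \<tau> \<omega> m = 1 / (4 * h ^ 4) * mom3 h p v"
    "coef_B n x \<tau> \<omega> m = - 5 / (4 * h ^ 4) * mom3 h p v + 3 / (2 * h ^ 3) * mom2 h p v"
    using c a g unfolding j p_def v_def by simp_all
  show "coef_a n x (m + 1) * node_theta n x \<tau> (m + 1) ^ 3 \<noteq> 0"
    unfolding th using coef_pos(1)[OF lt(1,2)] h by simp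
  show "\<omega> (m + 1) = (coef_A n x \<tau> \<omega> m + coef_B n x \<tau> \<omega> m - 1 / 4)
       / (coef_a n x (m + 1) * node_theta n x \<tau> (m + 1) ^ 3)"
    \<comment> \<open>In the sum \<open>v\<close> cancels:
      \<open>A + B = 1 / 4 + p / (2 * h)\<close>, while the denominator is
      \<open>1 / (4 * h)\<close>.\<close>
    unfolding w AB a th using h by (simp add: mom2_def mom3_def field_simps power_def)
qed

text \<open>Matching at both ends of the middle cell shows that its nodes are exactly
  \<open>\<tau> m\<close> and \<open>\<tau> (m + 1)\<close>. They lie symmetrically in it, and
  reflecting the B-splines factors the cubic.\<close>

lemma odd_middle:
  assumes nm: "n = 2 * m - 1"
  defines "D \<equiv> (coef_gamma n x (m + 1) + coef_a n x m) * node_theta n x \<tau> m ^ 3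
       + coef_eta n x (m + 1) * node_theta n x \<tau> m ^ 2
       + coef_alpha n x (m + 1) * node_rho n x \<tau> m ^ 3
       + coef_beta n x (m + 1) * node_rho n x \<tau> m ^ 2"
  shows "\<exists>r. r < node_theta n x \<tau> m \<and>
      {t \<in> {0<..<x m - x (m - 1)}. middle_cubic n x \<tau> \<omega> m t = 0} = {r, node_theta n x \<tau> m}"
    "D \<noteq> 0" "\<omega> m = coef_A n x \<tau> \<omega> (m - 1) / D"
proof -
  \<comment> \<open>As \<open>n \<ge> 2\<close> forces \<open>m \<ge> 2\<close>, the subtraction is
    not truncated.\<close>
  define i where "i = m - 2"
  define j where "j = m - 1"
  have ij: "m = Suc j" "j = Suc i" "n = 2 * j + 1" using nm n by (auto simp: i_def j_def)
  have lt: "j < M" "i < M" "m \<le> M" "m + 1 \<le> n" "Suc (Suc i) \<le> n" "m < n" "m \<le> n" "j \<le> n" "i \<le> n"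
    "0 < j" "0 < m" "j + m = n" "m + j = n" "j < n"
    using ij by auto
  have "ideal_v x j < ideal_v x m" using L.ideal_v_less[OF lt(1)] ij by simp
  hence I: "L.ideal_upto j" "R.ideal_upto j" and z: "on_knot j = {}" "on_knot m = {}"
    using middle_cases[OF lt(12)] middle_cases[OF lt(13)] lt by auto
  have "card (R.below j) = j" using I(2) by (simp add: R.ideal_upto_def)
  hence "card (L.below m) = m + 1" using card_split[OF lt(13)] z ij by simp
  moreover have "card (L.below j) = j" using I(1) by (simp add: L.ideal_upto_def)
  ultimately have "L.below j = {1..j}" "L.below m = {1..m + 1}"
    using below_initial[of j] below_initial[of m] by simp_all
  moreover have "L.cell j = L.below m - L.below j"
    using L.below_Suc[OF lt(1)] ij by auto
  ultimately have cell: "L.cell j = {m, m + 1}" using ij by auto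
  define h where "h = x m - x j"
  define g where "g = x (m + 1) - x m"
  have hg: "h > 0" "g > 0" "g + h > 0"
    using knot_less[of j] knot_less[of m] lt ij by (auto simp: h_def g_def)
  have "n - i = m + 1" "n - j = m" using ij by auto
  hence "x j - x i = g" using knot_sym[OF lt(9)] knot_sym[OF lt(8)] by (simp add: g_def)
  hence s: "step n x (m + 1) = g" "step n x m = h" "step n x j = g"
    using step_Suc[of m] step_Suc[of j] step_Suc[of i] lt ij by (auto simp: h_def g_def)
  define p v where "p = L.P j" and "v = L.V j"
  have pv: "p \<ge> 0" "v \<ge> 0" using L.ideal_nonneg[of j] I(1) lt
    by (auto simp: p_def v_def L.ideal_upto_def)
  have "R.P j = p" "R.V j = v" using I
    by (auto simp: p_def v_def L.ideal_upto_def R.ideal_upto_def)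
  hence PV: "L.P m = - p" "L.V m = v"
    using P_glue[OF lt(13)] V_glue[OF lt(13)] z by auto
  define y1 y2 where "y1 = x m - \<tau> m" and "y2 = x m - \<tau> (m + 1)"
  have "m + 1 \<in> L.cell j" using cell by simp
  hence y2: "y2 > 0" unfolding L.cell_def y2_def ij(1)[symmetric] by simp
  have y12: "y2 < y1" using node_less[of m "m + 1"] lt by (simp add: y1_def y2_def)
  hence ne: "y1 \<noteq> y2" by simp
  have m2: "\<omega> m * y1 ^ 2 + \<omega> (m + 1) * y2 ^ 2 = mom2 h p v"
    using L.cell_mom2[OF lt(1)] cell
    unfolding ij(1)[symmetric] by (simp add: y1_def y2_def h_def p_def v_def)
  have m3: "\<omega> m * y1 ^ 3 + \<omega> (m + 1) * y2 ^ 3 = mom3 h p v"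
    using L.cell_mom3[OF lt(1)] cell
    unfolding ij(1)[symmetric] by (simp add: y1_def y2_def h_def p_def v_def)
  have m0: "\<omega> m + \<omega> (m + 1) = 2 * p + h"
    using L.P_Suc[OF lt(1)] cell PV(1)
    unfolding ij(1)[symmetric] by (simp add: h_def p_def)
  have m1: "\<omega> m * y1 + \<omega> (m + 1) * y2 = p * h + h ^ 2 / 2"
    using L.V_Suc[OF lt(1)] cell PV(2)
    unfolding ij(1)[symmetric] by (simp add: y1_def y2_def h_def p_def v_def)
  note two = symmetric_two_nodes[OF hg(1) pv ne m0 m1 m2 m3]
  define w where "w = \<omega> m"
  have w: "w > 0" "\<omega> (m + 1) = w" using two by (simp_all add: w_def)
  have y2': "y2 = h - y1" using two(1) by simp
  have th: "node_theta n x \<tau> m = y1" using theta[OF lt(7)] by (simp add: y1_def)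
  have rh: "node_rho n x \<tau> m = y1 + g" using rho[of m] lt th by (simp add: g_def)
  define c where "c = coef_a n x m"
  define al where "al = coef_alpha n x m"
  define be where "be = coef_beta n x m"
  have cb: "c > 0" "be > 0" using coef_pos[of j] lt ij(1) by (simp_all add: c_def be_def)
  have "L.ideal_upto (Suc i)" using I ij by simp
  note c' = coef_eqs[OF this lt(2,5), folded ij(2), folded ij(1),
      folded h_def p_def v_def c_def al_def be_def]
  have m2': "mom2 h p v = w * (y1 ^ 2 + y2 ^ 2)" and m3': "mom3 h p v = w * (y1 ^ 3 + y2 ^ 3)"
    using m2 m3 w(2) by (simp_all add: w_def distrib_left)
  have A: "coef_A n x \<tau> \<omega> j = w * c * (y1 ^ 3 + y2 ^ 3)"
    and B: "coef_B n x \<tau> \<omega> j = w * (al * (y1 ^ 3 + y2 ^ 3) + be * (y1 ^ 2 + y2 ^ 2))"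
    unfolding c' m2' m3' by (simp_all add: algebra_simps)
  have alg1: "coef_gamma n x (m + 1) * t ^ 3 + coef_eta n x (m + 1) * t ^ 2
      + coef_alpha n x (m + 1) * (t + g) ^ 3 + coef_beta n x (m + 1) * (t + g) ^ 2
      = c * (h - t) ^ 3" for t
    using outer_bspline_reflect[OF hg(1,2), of t] s ij(1)
    by (simp add: coef_gamma_def coef_eta_def coef_alpha_def coef_beta_def coef_a_def c_def Let_def)
  have alg2: "coef_a n x (m + 1) * (t + g) ^ 3 + coef_b n x (m + 1) * t ^ 3
      + coef_c n x (m + 1) * t ^ 2 = al * (h - t) ^ 3 + be * (h - t) ^ 2" for t
    using inner_bspline_reflect[OF hg(1,2), of t] s ij(1)
    by (simp add: coef_a_def coef_b_def coef_c_def al_def be_def coef_alpha_def coef_beta_def Let_def)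
  have D: "D = c * (y1 ^ 3 + y2 ^ 3)"
    using alg1[of y1] unfolding D_def th rh c_def[symmetric] y2' by (simp add: algebra_simps)
  have "y1 ^ 3 + y2 ^ 3 > 0" using y2 y12 by (intro add_pos_pos zero_less_power) auto
  thus "D \<noteq> 0" "\<omega> m = coef_A n x \<tau> \<omega> (m - 1) / D"
    unfolding D using A cb(1) by (simp_all add: j_def w_def)
  have mc: "middle_cubic n x \<tau> \<omega> m t = w * c * be * h ^ 3 * ((t - y1) * (y2 - t))" for t
  proof -
    define A' B' where "A' = coef_A n x \<tau> \<omega> j" and "B' = coef_B n x \<tau> \<omega> j"
    have "t + x (m + 1) - x m = t + g" by (simp add: g_def)
    hence "middle_cubic n x \<tau> \<omega> m t =
       A' * (al * t ^ 3 + be * t ^ 2 + (coef_a n x (m + 1) * (t + g) ^ 3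
         + coef_b n x (m + 1) * t ^ 3 + coef_c n x (m + 1) * t ^ 2))
       - B' * (c * t ^ 3 + (coef_gamma n x (m + 1) * t ^ 3 + coef_eta n x (m + 1) * t ^ 2
         + coef_alpha n x (m + 1) * (t + g) ^ 3 + coef_beta n x (m + 1) * (t + g) ^ 2))"
      unfolding middle_cubic_def Let_def j_def[symmetric] A'_def[symmetric] B'_def[symmetric]
        c_def[symmetric] al_def[symmetric] be_def[symmetric]
      by (simp add: algebra_simps)
    also have "\<dots> = w * c * be * ((y1 ^ 3 + y2 ^ 3) * (t ^ 2 + (h - t) ^ 2)
         - (y1 ^ 2 + y2 ^ 2) * (t ^ 3 + (h - t) ^ 3))"
      unfolding alg1 alg2 unfolding A'_def B'_def A B by (simp add: algebra_simps)
    \<comment> \<open>Both power sums of \<open>t\<close> and \<open>h - t\<close> are quadratics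
      symmetric about \<open>h / 2\<close>, and \<open>y1 + y2 = h\<close>; so the cubic terms
      vanish and \<open>y1\<close>, \<open>y2\<close> are the roots.\<close>
    also have "(y1 ^ 3 + y2 ^ 3) * (t ^ 2 + (h - t) ^ 2) - (y1 ^ 2 + y2 ^ 2) * (t ^ 3 + (h - t) ^ 3)
        = h ^ 3 * ((t - y1) * (y2 - t))"
      unfolding y2' by (simp add: algebra_simps power_def)
    finally show ?thesis by simp
  qed
  have "w * c * be * h ^ 3 \<noteq> 0" using w cb hg by simp
  hence "middle_cubic n x \<tau> \<omega> m t = 0 \<longleftrightarrow> t = y1 \<or> t = y2" for t unfolding mc by auto
  moreover have "x m - x (m - 1) = h" by (simp add: h_def j_def)
  ultimately have "{t \<in> {0<..<x m - x (m - 1)}. middle_cubic n x \<tau> \<omega> m t = 0} = {y2, y1}"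
    using y2 y12 y2' by auto
  thus "\<exists>r. r < node_theta n x \<tau> m \<and>
      {t \<in> {0<..<x m - x (m - 1)}. middle_cubic n x \<tau> \<omega> m t = 0} = {r, node_theta n x \<tau> m}"
    unfolding th using y12 by blast
qed

end

theorem theorem2p1:
  fixes n :: nat and a b :: real and x \<tau> \<omega> :: "nat \<Rightarrow> real"
  assumes "n \<ge> 2" and "a < b"
    and "symmetrically_stretched_knots a b n x"
    and "gaussian_rule n x \<tau> \<omega>"
  shows "let h = step n x;
             aa = coef_a n x; \<alpha> = coef_alpha n x; \<beta> = coef_beta n x;
             \<gamma> = coef_gamma n x; \<eta> = coef_eta n x;
             \<theta> = node_theta n x \<tau>; \<rho> = node_rho n x \<tau>;
             A = coef_A n x \<tau> \<omega>; B = coef_B n x \<tau> \<omega>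
    in
      \<theta> 1 = 3 / 4 * h 1 \<and> \<omega> 1 = 16 / 27 * h 1 \<and>
      (\<forall>i\<in>{1..n div 2 - 1}.
         aa (i + 1) * B i - \<alpha> (i + 1) * A i \<noteq> 0 \<and>
         \<theta> (i + 1) = A i * \<beta> (i + 1) / (aa (i + 1) * B i - \<alpha> (i + 1) * A i) \<and>
         aa (i + 1) * \<theta> (i + 1) ^ 3 \<noteq> 0 \<and>
         \<omega> (i + 1) = A i / (aa (i + 1) * \<theta> (i + 1) ^ 3)) \<and>
      (\<forall>m. n = 2 * m \<longrightarrow>
         \<tau> (m + 1) = x m \<and> x m = (a + b) / 2 \<and>
         aa (m + 1) * \<theta> (m + 1) ^ 3 \<noteq> 0 \<and>
         \<omega> (m + 1) = (A m + B m - 1 / 4) / (aa (m + 1) * \<theta> (m + 1) ^ 3)) \<and>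
      (\<forall>m. n = 2 * m - 1 \<longrightarrow>
         (\<exists>r. r < \<theta> m \<and>
              {t \<in> {0<..<x m - x (m - 1)}. middle_cubic n x \<tau> \<omega> m t = 0} = {r, \<theta> m}) \<and>
         (\<gamma> (m + 1) + aa m) * \<theta> m ^ 3 + \<eta> (m + 1) * \<theta> m ^ 2
           + \<alpha> (m + 1) * \<rho> m ^ 3 + \<beta> (m + 1) * \<rho> m ^ 2 \<noteq> 0 \<and>
         \<omega> m = A (m - 1) / ((\<gamma> (m + 1) + aa m) * \<theta> m ^ 3 + \<eta> (m + 1) * \<theta> m ^ 2
                             + \<alpha> (m + 1) * \<rho> m ^ 3 + \<beta> (m + 1) * \<rho> m ^ 2))"
proof -
  interpret symmetric_rule n a b x \<tau> \<omega>
    using assms by unfold_locales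
  show ?thesis
    unfolding Let_def using first_node recurrence even_middle odd_middle by blast
qed

end
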